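(* The category $\mathbf{IStr}$ is equivalent to the full subcategory of $\mathcal{R}$ consisting of simple incidence hypergraphs, and this subcategory is reflective in $\mathcal{R}$. Moreover, $\mathbf{IStr}$ is complete and cocomplete, and its limits and colimits are obtained by passing to $\mathcal{R}$ and then applying the simplification: for a small diagram $D$ in $\mathbf{IStr}$, a limit (resp. colimit) of $D$ is $\mathcal{S}_{\mathcal{R}}$ applied to a limit (resp. colimit) of $\mathcal{N}_{\mathcal{R}}\circ D$ in $\mathcal{R}$.
   Context: $\mathcal{R}$ is the category of incidence hypergraphs: objects are $G=(V(G),E(G),I(G),\varsigma_G,\omega_G)$ with sets $V(G)$ (vertices), $E(G)$ (edges), $I(G)$ (incidences) and functions $\varsigma_G:I(G)\to V(G)$, $\omega_G:I(G)\to E(G)$; a morphism $G\to G'$ is a triple of functions $(V(\phi),E(\phi),I(\phi))$ with $\varsigma_{G'}\circ I(\phi)=V(\phi)\circ\varsigma_G$ and $\omega_{G'}\circ I(\phi)=E(\phi)\circ\omega_G$. $G$ is simple if $i\mapsto(\varsigma_G(i),\omega_G(i))$, $I(G)\to V(G)\times E(G)$, is injective. $\mathbf{IStr}$ is the category of incidence structures: objects are triples $(V,E,\alpha)$ with sets $V,E$ and $\alpha\subseteq V\times E$; morphisms $(V,E,\alpha)\to(V',E',\alpha')$ are pairs of functions $f:V\to V'$, $g:E\to E'$ with $(f(v),g(e))\in\alpha'$ whenever $(v,e)\in\alpha$. The functor $\mathcal{N}_{\mathcal{R}}:\mathbf{IStr}\to\mathcal{R}$ sends $(V,E,\alpha)$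 to $(V,E,\alpha,\pi_V|_\alpha,\pi_E|_\alpha)$ and $(f,g)$ to $(f,g,(f\times g)|_\alpha)$. The simplification functor $\mathcal{S}_{\mathcal{R}}:\mathcal{R}\to\mathbf{IStr}$ sends $G$ to $(V(G),E(G),\{(\varsigma_G(i),\omega_G(i)):i\in I(G)\})$ and $\phi$ to $(V(\phi),E(\phi))$. *)

theory Defs
  imports "HOL-Library.FuncSet" "HOL-Library.Nat_Bijection"
begin

unbundle cardinal_syntax

section \<open>A universe of sets\<close>

text \<open>
  HOL has no type of all sets, so sets are taken relative to a universe: a type \<open>'u\<close> whose
  subsets of cardinality strictly below that of \<open>'u\<close> are the sets (\<open>small\<close>) and whose other subsets
  are proper classes.  The class axioms are the closure conditions of a Grothendieck universe
  (ordered pairs, power sets, unions of small families); they say that the cardinality of \<open>'u\<close> is an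
  infinite regular strong limit.  Uncountability is not imposed, so everything below applies in
  particular to every strongly inaccessible universe.
\<close>

definition small :: "'a set \<Rightarrow> bool" where
  "small A \<longleftrightarrow> |A| <o |UNIV :: 'a set|"

class universe =
  fixes upair :: "'a \<Rightarrow> 'a \<Rightarrow> 'a"
  assumes upair_inject: "upair a b = upair c d \<longleftrightarrow> a = c \<and> b = d"
    and small_Pow: "small (A :: 'a set) \<Longrightarrow> |Pow A| <o |UNIV :: 'a set|"
    and small_UN: "small (A :: 'a set) \<Longrightarrow> (\<And>a. a \<in> A \<Longrightarrow> small (F a :: 'a set)) \<Longrightarrow> small (\<Union>a\<in>A. F a)"

definition ufst :: "'u::universe \<Rightarrow> 'u" where
  "ufst z = (THE a. \<exists>b. z = upair a b)"

definition usnd :: "'u::universe \<Rightarrow> 'u" where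
  "usnd z = (THE b. \<exists>a. z = upair a b)"

lemma ufst_upair [simp]: "ufst (upair a b) = a"
  by (auto simp: ufst_def upair_inject)

lemma usnd_upair [simp]: "usnd (upair a b) = b"
  by (auto simp: usnd_def upair_inject)

lemma small_nat_iff: "small (A :: nat set) \<longleftrightarrow> finite A"
  unfolding small_def finite_iff_ordLess_natLeq
  using card_of_nat ordIso_symmetric ordLess_ordIso_trans by blast

text \<open>The universe axioms are consistent with HOL: on \<open>nat\<close> the small sets are the finite ones.\<close>

instantiation nat :: universe
begin

definition "upair_nat a b = prod_encode (a, b)"

instance
proof
  fix a b c d :: nat
  show "upair a b = upair c d \<longleftrightarrow> a = c \<and> b = d"
    by (simp add: upair_nat_def)
next
  fix A :: "nat set"
  assume "small A"
  then show "|Pow A| <o |UNIV :: nat set|"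
    by (metis small_nat_iff finite_Pow_iff finite_iff_ordLess_natLeq card_of_nat ordIso_symmetric
        ordLess_ordIso_trans)
next
  fix A :: "nat set" and F :: "nat \<Rightarrow> nat set"
  assume "small A" "\<And>a. a \<in> A \<Longrightarrow> small (F a)"
  then show "small (\<Union>a\<in>A. F a)"
    by (simp add: small_nat_iff)
qed

end

lemma small_subset: "small B \<Longrightarrow> A \<subseteq> B \<Longrightarrow> small A"
  unfolding small_def using card_of_mono1 ordLeq_ordLess_trans by blast

lemma small_image: "small A \<Longrightarrow> small (f ` A)" for f :: "'u \<Rightarrow> 'u"
  unfolding small_def using card_of_image ordLeq_ordLess_trans by blast

lemma small_upair_image:
  assumes "small V" "small E" "\<alpha> \<subseteq> V \<times> E"
  shows "small ((\<lambda>(v, e). upair v e) ` \<alpha> :: 'u::universe set)"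
proof (rule small_subset)
  show "small (\<Union>v\<in>V. upair v ` E)"
    by (intro small_UN small_image assms)
  show "(\<lambda>(v, e). upair v e) ` \<alpha> \<subseteq> (\<Union>v\<in>V. upair v ` E)"
    using assms(3) by auto
qed


section \<open>Categories\<close>

record ('o, 'a) cat =
  Obj :: "'o set"
  Arr :: "'a set"
  Dom :: "'a \<Rightarrow> 'o"
  Cod :: "'a \<Rightarrow> 'o"
  Ide :: "'o \<Rightarrow> 'a"
  Comp :: "'a \<Rightarrow> 'a \<Rightarrow> 'a"  \<comment> \<open>\<open>Comp C g f\<close> is g after f; only relevant if \<open>Cod f = Dom g\<close>\<close>

definition Hom :: "('o, 'a) cat \<Rightarrow> 'o \<Rightarrow> 'o \<Rightarrow> 'a set" where
  "Hom C x y = {f \<in> Arr C. Dom C f = x \<and> Cod C f = y}"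

definition category :: "('o, 'a) cat \<Rightarrow> bool" where
  "category C \<longleftrightarrow>
     (\<forall>f\<in>Arr C. Dom C f \<in> Obj C \<and> Cod C f \<in> Obj C) \<and>
     (\<forall>x\<in>Obj C. Ide C x \<in> Hom C x x) \<and>
     (\<forall>x y z f g. f \<in> Hom C x y \<and> g \<in> Hom C y z \<longrightarrow> Comp C g f \<in> Hom C x z) \<and>
     (\<forall>x y f. f \<in> Hom C x y \<longrightarrow> Comp C f (Ide C x) = f \<and> Comp C (Ide C y) f = f) \<and>
     (\<forall>w x y z f g h. f \<in> Hom C w x \<and> g \<in> Hom C x y \<and> h \<in> Hom C y z \<longrightarrow>
        Comp C h (Comp C g f) = Comp C (Comp C h g) f)"

definition full_subcategory :: "('o, 'a) cat \<Rightarrow> ('o \<Rightarrow> bool) \<Rightarrow> ('o, 'a) cat" where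
  "full_subcategory C P =
     C\<lparr>Obj := {x \<in> Obj C. P x}, Arr := {f \<in> Arr C. P (Dom C f) \<and> P (Cod C f)}\<rparr>"

definition iso_arr :: "('o, 'a) cat \<Rightarrow> 'a \<Rightarrow> bool" where
  "iso_arr C f \<longleftrightarrow> f \<in> Arr C \<and>
     (\<exists>g \<in> Hom C (Cod C f) (Dom C f).
        Comp C g f = Ide C (Dom C f) \<and> Comp C f g = Ide C (Cod C f))"

text \<open>The values of a functor outside the objects and arrows of its source are irrelevant.\<close>

record ('o1, 'a1, 'o2, 'a2) fnctr =
  FObj :: "'o1 \<Rightarrow> 'o2"
  FArr :: "'a1 \<Rightarrow> 'a2"

definition is_functor ::
  "('o1, 'a1) cat \<Rightarrow> ('o2, 'a2) cat \<Rightarrow> ('o1, 'a1, 'o2, 'a2) fnctr \<Rightarrow> bool" where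
  "is_functor C D F \<longleftrightarrow> category C \<and> category D \<and>
     (\<forall>x\<in>Obj C. FObj F x \<in> Obj D) \<and>
     (\<forall>x y f. f \<in> Hom C x y \<longrightarrow> FArr F f \<in> Hom D (FObj F x) (FObj F y)) \<and>
     (\<forall>x\<in>Obj C. FArr F (Ide C x) = Ide D (FObj F x)) \<and>
     (\<forall>x y z f g. f \<in> Hom C x y \<and> g \<in> Hom C y z \<longrightarrow>
        FArr F (Comp C g f) = Comp D (FArr F g) (FArr F f))"

definition id_functor :: "('o, 'a, 'o, 'a) fnctr" where
  "id_functor = \<lparr>FObj = (\<lambda>x. x), FArr = (\<lambda>f. f)\<rparr>"

definition comp_functor ::
  "('o2, 'a2, 'o3, 'a3) fnctr \<Rightarrow> ('o1, 'a1, 'o2, 'a2) fnctr \<Rightarrow> ('o1, 'a1, 'o3, 'a3) fnctr"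
  (infixl "\<circ>\<^sub>F" 55) where
  "G \<circ>\<^sub>F F = \<lparr>FObj = FObj G \<circ> FObj F, FArr = FArr G \<circ> FArr F\<rparr>"

definition nat_trans ::
  "('o1, 'a1) cat \<Rightarrow> ('o2, 'a2) cat \<Rightarrow> ('o1, 'a1, 'o2, 'a2) fnctr \<Rightarrow>
   ('o1, 'a1, 'o2, 'a2) fnctr \<Rightarrow> ('o1 \<Rightarrow> 'a2) \<Rightarrow> bool" where
  "nat_trans C D F G \<tau> \<longleftrightarrow> is_functor C D F \<and> is_functor C D G \<and>
     (\<forall>x\<in>Obj C. \<tau> x \<in> Hom D (FObj F x) (FObj G x)) \<and>
     (\<forall>x y f. f \<in> Hom C x y \<longrightarrow> Comp D (\<tau> y) (FArr F f) = Comp D (FArr G f) (\<tau> x))"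

definition nat_iso ::
  "('o1, 'a1) cat \<Rightarrow> ('o2, 'a2) cat \<Rightarrow> ('o1, 'a1, 'o2, 'a2) fnctr \<Rightarrow>
   ('o1, 'a1, 'o2, 'a2) fnctr \<Rightarrow> ('o1 \<Rightarrow> 'a2) \<Rightarrow> bool" where
  "nat_iso C D F G \<tau> \<longleftrightarrow> nat_trans C D F G \<tau> \<and> (\<forall>x\<in>Obj C. iso_arr D (\<tau> x))"

definition equivalent_categories :: "('o1, 'a1) cat \<Rightarrow> ('o2, 'a2) cat \<Rightarrow> bool" where
  "equivalent_categories C D \<longleftrightarrow>
     (\<exists>F G \<eta> \<epsilon>. is_functor C D F \<and> is_functor D C G \<and>
        nat_iso C C id_functor (G \<circ>\<^sub>F F) \<eta> \<and> nat_iso D D (F \<circ>\<^sub>F G) id_functor \<epsilon>)"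

definition adjunction ::
  "('o1, 'a1) cat \<Rightarrow> ('o2, 'a2) cat \<Rightarrow> ('o1, 'a1, 'o2, 'a2) fnctr \<Rightarrow>
   ('o2, 'a2, 'o1, 'a1) fnctr \<Rightarrow> ('o1 \<Rightarrow> 'a1) \<Rightarrow> ('o2 \<Rightarrow> 'a2) \<Rightarrow> bool" where
  "adjunction C D F G \<eta> \<epsilon> \<longleftrightarrow>
     is_functor C D F \<and> is_functor D C G \<and>
     nat_trans C C id_functor (G \<circ>\<^sub>F F) \<eta> \<and> nat_trans D D (F \<circ>\<^sub>F G) id_functor \<epsilon> \<and>
     (\<forall>x\<in>Obj C. Comp D (\<epsilon> (FObj F x)) (FArr F (\<eta> x)) = Ide D (FObj F x)) \<and>
     (\<forall>y\<in>Obj D. Comp C (FArr G (\<epsilon> y)) (\<eta> (FObj G y)) = Ide C (FObj G y))"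

text \<open>The inclusion of a full subcategory is \<open>id_functor\<close>, read with the smaller source.\<close>

definition reflective :: "('o, 'a) cat \<Rightarrow> ('o \<Rightarrow> bool) \<Rightarrow> bool" where
  "reflective C P \<longleftrightarrow> (\<exists>L \<eta> \<epsilon>. adjunction C (full_subcategory C P) L id_functor \<eta> \<epsilon>)"


subsection \<open>Limits and colimits\<close>

definition cone ::
  "('j, 'k) cat \<Rightarrow> ('o, 'a) cat \<Rightarrow> ('j, 'k, 'o, 'a) fnctr \<Rightarrow> 'o \<Rightarrow> ('j \<Rightarrow> 'a) \<Rightarrow> bool" where
  "cone J C D X \<pi> \<longleftrightarrow> is_functor J C D \<and> X \<in> Obj C \<and>
     (\<forall>j\<in>Obj J. \<pi> j \<in> Hom C X (FObj D j)) \<and>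
     (\<forall>i j u. u \<in> Hom J i j \<longrightarrow> Comp C (FArr D u) (\<pi> i) = \<pi> j)"

definition limit_cone ::
  "('j, 'k) cat \<Rightarrow> ('o, 'a) cat \<Rightarrow> ('j, 'k, 'o, 'a) fnctr \<Rightarrow> 'o \<Rightarrow> ('j \<Rightarrow> 'a) \<Rightarrow> bool" where
  "limit_cone J C D X \<pi> \<longleftrightarrow> cone J C D X \<pi> \<and>
     (\<forall>Y \<xi>. cone J C D Y \<xi> \<longrightarrow>
        (\<exists>!h. h \<in> Hom C Y X \<and> (\<forall>j\<in>Obj J. Comp C (\<pi> j) h = \<xi> j)))"

definition cocone ::
  "('j, 'k) cat \<Rightarrow> ('o, 'a) cat \<Rightarrow> ('j, 'k, 'o, 'a) fnctr \<Rightarrow> 'o \<Rightarrow> ('j \<Rightarrow> 'a) \<Rightarrow> bool" where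
  "cocone J C D X \<iota> \<longleftrightarrow> is_functor J C D \<and> X \<in> Obj C \<and>
     (\<forall>j\<in>Obj J. \<iota> j \<in> Hom C (FObj D j) X) \<and>
     (\<forall>i j u. u \<in> Hom J i j \<longrightarrow> Comp C (\<iota> j) (FArr D u) = \<iota> i)"

definition colimit_cocone ::
  "('j, 'k) cat \<Rightarrow> ('o, 'a) cat \<Rightarrow> ('j, 'k, 'o, 'a) fnctr \<Rightarrow> 'o \<Rightarrow> ('j \<Rightarrow> 'a) \<Rightarrow> bool" where
  "colimit_cocone J C D X \<iota> \<longleftrightarrow> cocone J C D X \<iota> \<and>
     (\<forall>Y \<xi>. cocone J C D Y \<xi> \<longrightarrow>
        (\<exists>!h. h \<in> Hom C X Y \<and> (\<forall>j\<in>Obj J. Comp C h (\<iota> j) = \<xi> j)))"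

text \<open>A small category has a set, i.e. a small subset of the universe, of objects and of arrows.\<close>

definition small_category :: "('u::universe, 'u) cat \<Rightarrow> bool" where
  "small_category J \<longleftrightarrow> category J \<and> small (Obj J) \<and> small (Arr J)"

definition complete_category :: "'u::universe itself \<Rightarrow> ('o, 'a) cat \<Rightarrow> bool" where
  "complete_category _ C \<longleftrightarrow> category C \<and>
     (\<forall>(J :: ('u, 'u) cat) D. small_category J \<and> is_functor J C D \<longrightarrow> (\<exists>X \<pi>. limit_cone J C D X \<pi>))"

definition cocomplete_category :: "'u::universe itself \<Rightarrow> ('o, 'a) cat \<Rightarrow> bool" where
  "cocomplete_category _ C \<longleftrightarrow> category C \<and>
     (\<forall>(J :: ('u, 'u) cat) D. small_category J \<and> is_functor J C D \<longrightarrow> (\<exists>X \<iota>. colimit_cocone J C D X \<iota>))"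


section \<open>Incidence hypergraphs\<close>

text \<open>
  Functions between sets are elements of the extensional function space, so that equality of
  functions with a given domain is HOL equality.
\<close>

record 'u hypergraph =
  verts :: "'u set"
  edges :: "'u set"
  incs :: "'u set"
  inc_vert :: "'u \<Rightarrow> 'u"
  inc_edge :: "'u \<Rightarrow> 'u"

definition is_hypergraph :: "'u::universe hypergraph \<Rightarrow> bool" where
  "is_hypergraph G \<longleftrightarrow> small (verts G) \<and> small (edges G) \<and> small (incs G) \<and>
     inc_vert G \<in> incs G \<rightarrow>\<^sub>E verts G \<and> inc_edge G \<in> incs G \<rightarrow>\<^sub>E edges G"

record 'u hyp_mor =
  hdom :: "'u hypergraph"
  hcod :: "'u hypergraph"
  vmap :: "'u \<Rightarrow> 'u"
  emap :: "'u \<Rightarrow> 'u"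
  imap :: "'u \<Rightarrow> 'u"

definition is_hyp_mor :: "'u::universe hyp_mor \<Rightarrow> bool" where
  "is_hyp_mor \<phi> \<longleftrightarrow> is_hypergraph (hdom \<phi>) \<and> is_hypergraph (hcod \<phi>) \<and>
     vmap \<phi> \<in> verts (hdom \<phi>) \<rightarrow>\<^sub>E verts (hcod \<phi>) \<and>
     emap \<phi> \<in> edges (hdom \<phi>) \<rightarrow>\<^sub>E edges (hcod \<phi>) \<and>
     imap \<phi> \<in> incs (hdom \<phi>) \<rightarrow>\<^sub>E incs (hcod \<phi>) \<and>
     (\<forall>i\<in>incs (hdom \<phi>).
        inc_vert (hcod \<phi>) (imap \<phi> i) = vmap \<phi> (inc_vert (hdom \<phi>) i) \<and>
        inc_edge (hcod \<phi>) (imap \<phi> i) = emap \<phi> (inc_edge (hdom \<phi>) i))"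

definition R_cat :: "('u::universe hypergraph, 'u hyp_mor) cat" where
  "R_cat = \<lparr>
     Obj = {G. is_hypergraph G},
     Arr = {\<phi>. is_hyp_mor \<phi>},
     Dom = hdom,
     Cod = hcod,
     Ide = (\<lambda>G. \<lparr>hdom = G, hcod = G, vmap = restrict id (verts G), emap = restrict id (edges G),
                imap = restrict id (incs G)\<rparr>),
     Comp = (\<lambda>\<psi> \<phi>. \<lparr>hdom = hdom \<phi>, hcod = hcod \<psi>,
                vmap = compose (verts (hdom \<phi>)) (vmap \<psi>) (vmap \<phi>),
                emap = compose (edges (hdom \<phi>)) (emap \<psi>) (emap \<phi>),
                imap = compose (incs (hdom \<phi>)) (imap \<psi>) (imap \<phi>)\<rparr>)\<rparr>"

definition simple_hypergraph :: "'u::universe hypergraph \<Rightarrow> bool" where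
  "simple_hypergraph G \<longleftrightarrow> inj_on (\<lambda>i. (inc_vert G i, inc_edge G i)) (incs G)"


section \<open>Incidence structures\<close>

record 'u inc_struct =
  points :: "'u set"
  blocks :: "'u set"
  incidence :: "('u \<times> 'u) set"

definition is_inc_struct :: "'u::universe inc_struct \<Rightarrow> bool" where
  "is_inc_struct A \<longleftrightarrow> small (points A) \<and> small (blocks A) \<and> incidence A \<subseteq> points A \<times> blocks A"

record 'u istr_mor =
  idom :: "'u inc_struct"
  icod :: "'u inc_struct"
  pmap :: "'u \<Rightarrow> 'u"
  bmap :: "'u \<Rightarrow> 'u"

definition is_istr_mor :: "'u::universe istr_mor \<Rightarrow> bool" where
  "is_istr_mor f \<longleftrightarrow> is_inc_struct (idom f) \<and> is_inc_struct (icod f) \<and>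
     pmap f \<in> points (idom f) \<rightarrow>\<^sub>E points (icod f) \<and>
     bmap f \<in> blocks (idom f) \<rightarrow>\<^sub>E blocks (icod f) \<and>
     (\<forall>v e. (v, e) \<in> incidence (idom f) \<longrightarrow> (pmap f v, bmap f e) \<in> incidence (icod f))"

definition IStr :: "('u::universe inc_struct, 'u istr_mor) cat" where
  "IStr = \<lparr>
     Obj = {A. is_inc_struct A},
     Arr = {f. is_istr_mor f},
     Dom = idom,
     Cod = icod,
     Ide = (\<lambda>A. \<lparr>idom = A, icod = A, pmap = restrict id (points A), bmap = restrict id (blocks A)\<rparr>),
     Comp = (\<lambda>g f. \<lparr>idom = idom f, icod = icod g,
                pmap = compose (points (idom f)) (pmap g) (pmap f),
                bmap = compose (blocks (idom f)) (bmap g) (bmap f)\<rparr>)\<rparr>"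


section \<open>The two functors\<close>

text \<open>The incidences of \<open>N_obj A\<close> are the pairs of the incidence relation, formed in the universe.\<close>

definition N_obj :: "'u::universe inc_struct \<Rightarrow> 'u hypergraph" where
  "N_obj A = (let I = (\<lambda>(v, e). upair v e) ` incidence A in
     \<lparr>verts = points A, edges = blocks A, incs = I, inc_vert = restrict ufst I, inc_edge = restrict usnd I\<rparr>)"

definition N_R :: "('u::universe inc_struct, 'u istr_mor, 'u hypergraph, 'u hyp_mor) fnctr" where
  "N_R = \<lparr>
     FObj = N_obj,
     FArr = (\<lambda>f. \<lparr>hdom = N_obj (idom f), hcod = N_obj (icod f), vmap = pmap f, emap = bmap f,
        imap = (\<lambda>i\<in>incs (N_obj (idom f)). upair (pmap f (ufst i)) (bmap f (usnd i)))\<rparr>)\<rparr>"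

definition S_obj :: "'u::universe hypergraph \<Rightarrow> 'u inc_struct" where
  "S_obj G = \<lparr>points = verts G, blocks = edges G,
     incidence = {(inc_vert G i, inc_edge G i) | i. i \<in> incs G}\<rparr>"

definition S_R :: "('u::universe hypergraph, 'u hyp_mor, 'u inc_struct, 'u istr_mor) fnctr" where
  "S_R = \<lparr>
     FObj = S_obj,
     FArr = (\<lambda>\<phi>. \<lparr>idom = S_obj (hdom \<phi>), icod = S_obj (hcod \<phi>), pmap = vmap \<phi>, bmap = emap \<phi>\<rparr>)\<rparr>"

lemma category_R_cat: "category (R_cat :: ('u::universe hypergraph, 'u hyp_mor) cat)"
  unfolding category_def
proof (intro conjI ballI allI impI)
  fix x y f assume "f \<in> Hom (R_cat :: ('u hypergraph, 'u hyp_mor) cat) x y"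
  then have f: "is_hyp_mor f" "hdom f = x" "hcod f = y" by (auto simp: Hom_def R_cat_def)
  show "Comp R_cat f (Ide R_cat x) = f" "Comp R_cat (Ide R_cat y) f = f"
    using f by (auto simp: R_cat_def is_hyp_mor_def compose_def fun_eq_iff PiE_iff extensional_def
        intro!: hyp_mor.equality)
next
  fix w x y z f g h
  assume "f \<in> Hom (R_cat :: ('u hypergraph, 'u hyp_mor) cat) w x \<and> g \<in> Hom R_cat x y \<and> h \<in> Hom R_cat y z"
  then show "Comp R_cat h (Comp R_cat g f) = Comp R_cat (Comp R_cat h g) f"
    by (auto simp: Hom_def R_cat_def is_hyp_mor_def compose_def fun_eq_iff PiE_iff)
qed (auto simp: Hom_def R_cat_def is_hyp_mor_def is_hypergraph_def compose_def PiE_iff)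

lemma category_IStr: "category (IStr :: ('u::universe inc_struct, 'u istr_mor) cat)"
  unfolding category_def
proof (intro conjI ballI allI impI)
  fix x y f assume "f \<in> Hom (IStr :: ('u inc_struct, 'u istr_mor) cat) x y"
  then have f: "is_istr_mor f" "idom f = x" "icod f = y" by (auto simp: Hom_def IStr_def)
  show "Comp IStr f (Ide IStr x) = f" "Comp IStr (Ide IStr y) f = f"
    using f by (auto simp: IStr_def is_istr_mor_def compose_def fun_eq_iff PiE_iff extensional_def
        intro!: istr_mor.equality)
next
  fix w x y z f g h
  assume "f \<in> Hom (IStr :: ('u inc_struct, 'u istr_mor) cat) w x \<and> g \<in> Hom IStr x y \<and> h \<in> Hom IStr y z"
  then show "Comp IStr h (Comp IStr g f) = Comp IStr (Comp IStr h g) f"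
    by (auto simp: Hom_def IStr_def is_istr_mor_def compose_def fun_eq_iff PiE_iff)
qed (auto simp: Hom_def IStr_def is_istr_mor_def is_inc_struct_def compose_def PiE_iff subset_iff)

lemma is_hypergraph_N_obj: "is_inc_struct A \<Longrightarrow> is_hypergraph (N_obj A)"
  by (auto simp: is_inc_struct_def is_hypergraph_def N_obj_def Let_def
      intro: small_upair_image)

lemma is_functor_N_R:
  "is_functor IStr R_cat (N_R :: ('u::universe inc_struct, 'u istr_mor, 'u hypergraph, 'u hyp_mor) fnctr)"
  unfolding is_functor_def
proof (intro conjI category_IStr category_R_cat ballI allI impI)
  fix x y f assume "f \<in> Hom (IStr :: ('u inc_struct, 'u istr_mor) cat) x y"
  then have f: "is_istr_mor f" "idom f = x" "icod f = y" by (auto simp: Hom_def IStr_def)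
  then have "is_hypergraph (N_obj x)" "is_hypergraph (N_obj y)"
    by (auto simp: is_istr_mor_def is_hypergraph_N_obj)
  then show "FArr N_R f \<in> Hom R_cat (FObj N_R x) (FObj N_R y)"
    using f by (auto simp: Hom_def R_cat_def N_R_def is_hyp_mor_def is_istr_mor_def N_obj_def Let_def)
next
  fix x y z f g
  assume "f \<in> Hom (IStr :: ('u inc_struct, 'u istr_mor) cat) x y \<and> g \<in> Hom IStr y z"
  then show "FArr N_R (Comp IStr g f) = Comp R_cat (FArr N_R g) (FArr N_R f)"
    by (auto simp: Hom_def IStr_def R_cat_def N_R_def N_obj_def Let_def compose_def fun_eq_iff
        is_istr_mor_def is_inc_struct_def)
next
  fix x assume "x \<in> Obj (IStr :: ('u inc_struct, 'u istr_mor) cat)"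
  then show "FArr N_R (Ide IStr x) = Ide R_cat (FObj N_R x)"
    by (auto simp: IStr_def R_cat_def N_R_def N_obj_def Let_def fun_eq_iff is_inc_struct_def)
qed (auto simp: IStr_def R_cat_def N_R_def is_hypergraph_N_obj)

lemma is_inc_struct_S_obj: "is_hypergraph G \<Longrightarrow> is_inc_struct (S_obj G)"
  by (auto simp: is_hypergraph_def is_inc_struct_def S_obj_def PiE_iff)

lemma is_functor_S_R:
  "is_functor R_cat IStr (S_R :: ('u::universe hypergraph, 'u hyp_mor, 'u inc_struct, 'u istr_mor) fnctr)"
  unfolding is_functor_def
proof (intro conjI category_IStr category_R_cat ballI allI impI)
  fix x y f assume "f \<in> Hom (R_cat :: ('u hypergraph, 'u hyp_mor) cat) x y"
  then have f: "is_hyp_mor f" "hdom f = x" "hcod f = y" by (auto simp: Hom_def R_cat_def)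
  then have "is_inc_struct (S_obj x)" "is_inc_struct (S_obj y)"
    by (auto simp: is_hyp_mor_def is_inc_struct_S_obj)
  then show "FArr S_R f \<in> Hom IStr (FObj S_R x) (FObj S_R y)"
    using f
    by (simp add: Hom_def IStr_def S_R_def is_hyp_mor_def is_istr_mor_def)
      (auto simp: S_obj_def PiE_iff Pi_iff, metis)
qed (auto simp: Hom_def IStr_def R_cat_def S_R_def is_inc_struct_S_obj[unfolded S_obj_def] S_obj_def)

text \<open>
  \<open>S_R\<close> is a strict left inverse of \<open>N_R\<close>; hence \<open>S_R\<close> sends (co)cones over \<open>N_R \<circ>\<^sub>F D\<close> to
  (co)cones over \<open>D\<close> itself.
\<close>

lemma S_R_N_R:
  shows "FObj S_R (FObj N_R A) = (A :: 'u::universe inc_struct)"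
    and "FArr S_R (FArr N_R f) = (f :: 'u istr_mor)"
proof -
  show *: "FObj S_R (FObj N_R A) = A" for A :: "'u inc_struct"
    by (rule inc_struct.equality) (force simp: S_R_def N_R_def S_obj_def N_obj_def Let_def)+
  show "FArr S_R (FArr N_R f) = f"
    using *[of "idom f"] *[of "icod f"] by (auto simp: S_R_def N_R_def intro!: istr_mor.equality)
qed

unbundle no cardinal_syntax

end

(*
  Simplification S is full: a morphism S G -> S H lifts to G -> H by choosing images of incidences,
  and the lift is unique when H is simple.  Since S (N A) = A, this carries the universal property of
  a limit or colimit of N D over to its simplification.  In the category of hypergraphs, limits
  and colimits are computed separately on vertices, edges and incidences, as for presheaves.
*)
theory Submission
  imports Defs
begin

section \<open>Calculating in the two categories\<close>

text \<open>Simplification is left adjoint to \<open>N_R\<close>, so its compatibility with colimits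
  is to be expected, but a left adjoint need not respect limits. Limits of
  \<open>N_R \<circ>\<^sub>F D\<close> are different because all their legs end in simple
  hypergraphs: two arrows into \<open>N_obj (FObj D j)\<close> agree as soon as \<open>S_R\<close>
  identifies them. A lift along \<open>S_R\<close> can therefore be recognised as a mediating arrow
  after composition with the legs. Colimits can really leave the simple hypergraphs: if two vertices
  and two edges are glued along a diagram object without incidences, an incidence on the first pair
  and one on the second become distinct incidences with equal ends, which \<open>S_R\<close> then
  merges. The other obstacle is size. Products and quotients have to consist of elements of the
  universe, so families are coded by elements and equivalence classes are replaced by chosen
  representatives.\<close>

lemma R_cat_simps [simp]:
  "G \<in> Obj R_cat \<longleftrightarrow> is_hypergraph G"
  "f \<in> Arr R_cat \<longleftrightarrow> is_hyp_mor f"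
  "Dom R_cat = hdom" "Cod R_cat = hcod"
  "f \<in> Hom R_cat G H \<longleftrightarrow> is_hyp_mor f \<and> hdom f = G \<and> hcod f = H"
  "hdom (Comp R_cat g f) = hdom f" "hcod (Comp R_cat g f) = hcod g"
  "vmap (Comp R_cat g f) = compose (verts (hdom f)) (vmap g) (vmap f)"
  "emap (Comp R_cat g f) = compose (edges (hdom f)) (emap g) (emap f)"
  "imap (Comp R_cat g f) = compose (incs (hdom f)) (imap g) (imap f)"
  "hdom (Ide R_cat G) = G" "hcod (Ide R_cat G) = G"
  "vmap (Ide R_cat G) = restrict id (verts G)"
  "emap (Ide R_cat G) = restrict id (edges G)"
  "imap (Ide R_cat G) = restrict id (incs G)"
  by (auto simp: R_cat_def Hom_def)

lemma IStr_simps [simp]: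
  "A \<in> Obj IStr \<longleftrightarrow> is_inc_struct A"
  "f \<in> Arr IStr \<longleftrightarrow> is_istr_mor f"
  "Dom IStr = idom" "Cod IStr = icod"
  "f \<in> Hom IStr A B \<longleftrightarrow> is_istr_mor f \<and> idom f = A \<and> icod f = B"
  by (auto simp: IStr_def Hom_def)

lemma category_ComposeI:
  "category C \<Longrightarrow> f \<in> Hom C x y \<Longrightarrow> g \<in> Hom C y z \<Longrightarrow> Comp C g f \<in> Hom C x z"
  unfolding category_def by blast

lemma category_IdeI: "category C \<Longrightarrow> x \<in> Obj C \<Longrightarrow> Ide C x \<in> Hom C x x"
  unfolding category_def by blast

lemma category_Hom_Obj: "category C \<Longrightarrow> f \<in> Hom C x y \<Longrightarrow> x \<in> Obj C \<and> y \<in> Obj C"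
  unfolding category_def Hom_def by blast

lemma is_hyp_mor_Comp:
  "is_hyp_mor f \<Longrightarrow> is_hyp_mor g \<Longrightarrow> hcod f = hdom g \<Longrightarrow> is_hyp_mor (Comp R_cat g f)"
  using category_ComposeI[OF category_R_cat, of f "hdom f" "hcod f" g "hcod g"] by simp

lemma is_hyp_mor_Ide: "is_hypergraph G \<Longrightarrow> is_hyp_mor (Ide R_cat G)"
  using category_IdeI[OF category_R_cat, of G] by simp

lemma hyp_mor_eqI:
  assumes "is_hyp_mor f" "is_hyp_mor g" "hdom f = hdom g" "hcod f = hcod g"
    and "\<And>v. v \<in> verts (hdom g) \<Longrightarrow> vmap f v = vmap g v"
    and "\<And>e. e \<in> edges (hdom g) \<Longrightarrow> emap f e = emap g e"
    and "\<And>i. i \<in> incs (hdom g) \<Longrightarrow> imap f i = imap g i"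
  shows "f = g"
proof (rule hyp_mor.equality)
  show "vmap f = vmap g" "emap f = emap g" "imap f = imap g"
    using assms unfolding is_hyp_mor_def by (metis PiE_ext)+
qed (use assms in auto)

text \<open>The vertex and edge maps prescribe the ends of the image of an incidence, and in a
  simple codomain the ends determine the incidence. This settles every diagram of the reflection and
  of the equivalence without looking at incidences.\<close>

lemma hyp_mor_eqI_simple:
  assumes f: "is_hyp_mor f" and g: "is_hyp_mor g" and eq: "hdom f = hdom g" "hcod f = hcod g"
    and simple: "simple_hypergraph (hcod g)"
    and v: "\<And>v. v \<in> verts (hdom g) \<Longrightarrow> vmap f v = vmap g v"
    and e: "\<And>e. e \<in> edges (hdom g) \<Longrightarrow> emap f e = emap g e"
  shows "f = g"
proof (rule hyp_mor_eqI[OF f g eq v e])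
  fix i assume i: "i \<in> incs (hdom g)"
  have "is_hypergraph (hdom g)" using g by (simp add: is_hyp_mor_def)
  with i have ends: "inc_vert (hdom g) i \<in> verts (hdom g)" "inc_edge (hdom g) i \<in> edges (hdom g)"
    by (auto simp: is_hypergraph_def)
  show "imap f i = imap g i"
  proof (rule inj_onD[OF simple[unfolded simple_hypergraph_def]])
    show "(inc_vert (hcod g) (imap f i), inc_edge (hcod g) (imap f i)) =
      (inc_vert (hcod g) (imap g i), inc_edge (hcod g) (imap g i))"
      using f g eq i ends by (simp add: is_hyp_mor_def v e)
    show "imap f i \<in> incs (hcod g)" "imap g i \<in> incs (hcod g)"
      using f g eq i by (auto simp: is_hyp_mor_def)
  qed
qed

section \<open>The two functors, and what simplification remembers of a morphism\<close>

lemma N_obj_simps [simp]: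
  "verts (N_obj A) = points A" "edges (N_obj A) = blocks A"
  "incs (N_obj A) = (\<lambda>(v, e). upair v e) ` incidence A"
  "(v, e) \<in> incidence A \<Longrightarrow> inc_vert (N_obj A) (upair v e) = v"
  "(v, e) \<in> incidence A \<Longrightarrow> inc_edge (N_obj A) (upair v e) = e"
  by (force simp: N_obj_def Let_def)+

lemma S_obj_simps [simp]:
  "points (S_obj G) = verts G" "blocks (S_obj G) = edges G"
  "p \<in> incidence (S_obj G) \<longleftrightarrow> (\<exists>i\<in>incs G. p = (inc_vert G i, inc_edge G i))"
  by (auto simp: S_obj_def)

lemma simple_N_obj: "simple_hypergraph (N_obj A)"
  by (force simp: simple_hypergraph_def inj_on_def)

lemma S_N_obj [simp]: "S_obj (N_obj A) = A"
  using S_R_N_R(1)[of A] by (simp add: S_R_def N_R_def)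

lemma R_arr_simps [simp]:
  "FObj N_R = N_obj" "FObj S_R = S_obj"
  "hdom (FArr N_R f) = N_obj (idom f)" "hcod (FArr N_R f) = N_obj (icod f)"
  "vmap (FArr N_R f) = pmap f" "emap (FArr N_R f) = bmap f"
  "idom (FArr S_R \<phi>) = S_obj (hdom \<phi>)" "icod (FArr S_R \<phi>) = S_obj (hcod \<phi>)"
  "pmap (FArr S_R \<phi>) = vmap \<phi>" "bmap (FArr S_R \<phi>) = emap \<phi>"
  by (auto simp: N_R_def S_R_def)

lemma is_hyp_mor_N_R: "is_istr_mor f \<Longrightarrow> is_hyp_mor (FArr N_R f)"
  using is_functor_N_R[unfolded is_functor_def] by force

lemma is_istr_mor_S_R: "is_hyp_mor \<phi> \<Longrightarrow> is_istr_mor (FArr S_R \<phi>)"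
  using is_functor_S_R[unfolded is_functor_def] by force

text \<open>\<open>S_R\<close> forgets only \<open>imap\<close>, and simplicity of the codomain
  recovers it.\<close>

lemma S_R_faithful_into_simple:
  assumes "is_hyp_mor f" "is_hyp_mor g" "hdom f = hdom g" "hcod f = hcod g"
    and "simple_hypergraph (hcod g)" "FArr S_R f = FArr S_R g"
  shows "f = g"
proof (rule hyp_mor_eqI_simple)
  show "vmap f v = vmap g v" "emap f e = emap g e" for v e
    using assms(6) by (metis R_arr_simps(9,10))+
qed (use assms in auto)

text \<open>The image under \<open>k\<close> of the pair of ends of an incidence is again the pair
  of ends of at least one incidence of \<open>Y\<close>. No condition links the choices made for
  different incidences, so any selection gives a morphism.\<close>

lemma S_R_full:
  assumes k: "is_istr_mor k" "idom k = S_obj X" "icod k = S_obj Y"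
    and X: "is_hypergraph X" and Y: "is_hypergraph Y"
  shows "\<exists>h. h \<in> Hom R_cat X Y \<and> FArr S_R h = k"
proof -
  have "\<forall>i\<in>incs X. \<exists>y\<in>incs Y.
      inc_vert Y y = pmap k (inc_vert X i) \<and> inc_edge Y y = bmap k (inc_edge X i)"
    using k by (force simp: is_istr_mor_def)
  then obtain s where s: "\<And>i. i \<in> incs X \<Longrightarrow> s i \<in> incs Y \<and>
      inc_vert Y (s i) = pmap k (inc_vert X i) \<and> inc_edge Y (s i) = bmap k (inc_edge X i)"
    by (metis (no_types, lifting) bchoice)
  define h where "h = \<lparr>hdom = X, hcod = Y, vmap = pmap k, emap = bmap k,
    imap = restrict s (incs X)\<rparr>"
  have "is_hyp_mor h"
    using s k X Y unfolding is_hyp_mor_def h_def by (simp add: is_istr_mor_def)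
  moreover have "FArr S_R h = k"
    using k by (auto intro!: istr_mor.equality simp: h_def)
  ultimately show ?thesis by (intro exI[of _ h]) (simp add: h_def)
qed

section \<open>The equivalence and the reflection\<close>

lemma full_subcategory_simps [simp]:
  "x \<in> Obj (full_subcategory C P) \<longleftrightarrow> x \<in> Obj C \<and> P x"
  "f \<in> Hom (full_subcategory C P) x y \<longleftrightarrow> f \<in> Hom C x y \<and> P x \<and> P y"
  "Dom (full_subcategory C P) = Dom C" "Cod (full_subcategory C P) = Cod C"
  "Ide (full_subcategory C P) = Ide C" "Comp (full_subcategory C P) = Comp C"
  by (auto simp: full_subcategory_def Hom_def)

lemma category_full_subcategory:
  assumes "category C"
  shows "category (full_subcategory C P)"
  using assms unfolding category_def full_subcategory_simps
  by (simp add: full_subcategory_def) meson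

lemma is_functor_into_full:
  assumes "is_functor C D F" and "\<And>x. x \<in> Obj C \<Longrightarrow> P (FObj F x)"
  shows "is_functor C (full_subcategory D P) F"
proof -
  have "\<And>x y f. f \<in> Hom C x y \<Longrightarrow> x \<in> Obj C \<and> y \<in> Obj C"
    using assms(1) category_Hom_Obj unfolding is_functor_def by metis
  then show ?thesis
    using assms by (auto simp: is_functor_def category_full_subcategory simp del: R_cat_simps)
qed

lemma is_functor_from_full:
  "is_functor C D F \<Longrightarrow> is_functor (full_subcategory C P) D F"
  unfolding is_functor_def full_subcategory_simps
  by (simp add: category_full_subcategory) meson

lemma is_functor_id: "category C \<Longrightarrow> is_functor C C id_functor"
  by (simp add: is_functor_def id_functor_def)

lemma comp_functor_simps [simp]:
  "FObj (G \<circ>\<^sub>F F) x = FObj G (FObj F x)" "FArr (G \<circ>\<^sub>F F) f = FArr G (FArr F f)"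
  by (simp_all add: comp_functor_def)

lemma id_functor_simps [simp]: "FObj id_functor x = x" "FArr id_functor f = f"
  by (simp_all add: id_functor_def)

lemma is_functor_comp:
  "is_functor C D F \<Longrightarrow> is_functor D E G \<Longrightarrow> is_functor C E (G \<circ>\<^sub>F F)"
  unfolding is_functor_def comp_functor_simps by metis

section \<open>Unit and counit of the reflection\<close>

definition R_unit :: "'u::universe hypergraph \<Rightarrow> 'u hyp_mor" where
  "R_unit G = \<lparr>hdom = G, hcod = N_obj (S_obj G), vmap = restrict id (verts G),
     emap = restrict id (edges G), imap = (\<lambda>i\<in>incs G. upair (inc_vert G i) (inc_edge G i))\<rparr>"

text \<open>In a simple \<open>G\<close> each coded pair comes from exactly one incidence, and
  \<open>inv_into\<close> then inverts the incidence part of \<open>R_unit\<close>. An inverse is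
  required because \<open>N_obj (S_obj G)\<close> has coded pairs as incidences and so is in general
  only isomorphic to \<open>G\<close>.\<close>

definition R_counit :: "'u::universe hypergraph \<Rightarrow> 'u hyp_mor" where
  "R_counit G = \<lparr>hdom = N_obj (S_obj G), hcod = G, vmap = restrict id (verts G),
     emap = restrict id (edges G),
     imap = restrict (inv_into (incs G) (\<lambda>i. upair (inc_vert G i) (inc_edge G i)))
       (incs (N_obj (S_obj G)))\<rparr>"

lemma R_unit_simps [simp]:
  "hdom (R_unit G) = G" "hcod (R_unit G) = N_obj (S_obj G)"
  "vmap (R_unit G) = restrict id (verts G)" "emap (R_unit G) = restrict id (edges G)"
  "hdom (R_counit G) = N_obj (S_obj G)" "hcod (R_counit G) = G"
  "vmap (R_counit G) = restrict id (verts G)" "emap (R_counit G) = restrict id (edges G)"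
  by (auto simp: R_unit_def R_counit_def)

lemma is_hypergraph_N_S: "is_hypergraph G \<Longrightarrow> is_hypergraph (N_obj (S_obj G))"
  by (simp add: is_hypergraph_N_obj is_inc_struct_S_obj)

text \<open>Indexed by incidences of \<open>G\<close> instead of by pairs, the coded pairs are
  visibly the image of the incidence part of \<open>R_unit\<close>. The proofs about unit and counit
  use this form and switch off \<open>N_obj_simps(3)\<close>, which would expand to pairs.\<close>

lemma incs_N_S: "incs (N_obj (S_obj G)) = (\<lambda>i. upair (inc_vert G i) (inc_edge G i)) ` incs G"
  by (force simp: S_obj_def image_iff)

lemma inc_N_S:
  assumes "i \<in> incs G"
  shows "inc_vert (N_obj (S_obj G)) (upair (inc_vert G i) (inc_edge G i)) = inc_vert G i"
    and "inc_edge (N_obj (S_obj G)) (upair (inc_vert G i) (inc_edge G i)) = inc_edge G i"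
  using assms by (auto intro!: N_obj_simps(4,5))

lemma is_hyp_mor_unit:
  assumes "is_hypergraph G"
  shows "is_hyp_mor (R_unit G)"
  using assms is_hypergraph_N_S[OF assms]
  by (auto simp: is_hyp_mor_def R_unit_def inc_N_S incs_N_S is_hypergraph_def PiE_iff
      simp del: N_obj_simps(3))

lemma is_hyp_mor_counit:
  assumes G: "is_hypergraph G" and simple: "simple_hypergraph G"
  shows "is_hyp_mor (R_counit G)"
proof -
  let ?p = "\<lambda>i. upair (inc_vert G i) (inc_edge G i)"
  have inj: "inj_on ?p (incs G)"
    using simple by (auto simp: simple_hypergraph_def inj_on_def upair_inject)
  show ?thesis
    using G is_hypergraph_N_S[OF G]
    by (auto simp: is_hyp_mor_def R_counit_def incs_N_S inv_into_f_f[OF inj] inc_N_S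
        is_hypergraph_def PiE_iff simp del: N_obj_simps(3))
qed

lemma hyp_mor_maps_mem [simp]:
  "is_hyp_mor f \<Longrightarrow> v \<in> verts (hdom f) \<Longrightarrow> vmap f v \<in> verts (hcod f)"
  "is_hyp_mor f \<Longrightarrow> e \<in> edges (hdom f) \<Longrightarrow> emap f e \<in> edges (hcod f)"
  by (auto simp: is_hyp_mor_def)

abbreviation (input) R_simple :: "('u::universe hypergraph, 'u hyp_mor) cat" where
  "R_simple \<equiv> full_subcategory R_cat simple_hypergraph"

lemma is_functor_N_S: "is_functor R_cat R_simple (N_R \<circ>\<^sub>F S_R)"
  by (rule is_functor_into_full[OF is_functor_comp[OF is_functor_S_R is_functor_N_R]])
    (simp add: simple_N_obj)

lemma is_functor_inclusion: "is_functor R_simple R_cat id_functor"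
  by (intro is_functor_from_full is_functor_id category_R_cat)

lemma nat_trans_unit: "nat_trans R_cat R_cat id_functor (id_functor \<circ>\<^sub>F (N_R \<circ>\<^sub>F S_R)) R_unit"
  unfolding nat_trans_def
proof (intro conjI ballI allI impI)
  show "is_functor R_cat R_cat id_functor" by (rule is_functor_id[OF category_R_cat])
  show "is_functor R_cat R_cat (id_functor \<circ>\<^sub>F (N_R \<circ>\<^sub>F S_R))"
    by (rule is_functor_comp[OF is_functor_N_S is_functor_inclusion])
  fix x y f assume "f \<in> Hom (R_cat :: ('a hypergraph, 'a hyp_mor) cat) x y"
  then have f: "is_hyp_mor f" "hdom f = x" "hcod f = y" "is_hypergraph x" "is_hypergraph y"
    by (auto simp: is_hyp_mor_def)
  show "Comp R_cat (R_unit y) (FArr id_functor f) =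
      Comp R_cat (FArr (id_functor \<circ>\<^sub>F (N_R \<circ>\<^sub>F S_R)) f) (R_unit x)"
    \<comment> \<open>Both composites end in \<open>N_obj (S_obj y)\<close>, which is simple, so
      only vertices and edges are compared; there the unit is the identity.\<close>
    using f by (intro hyp_mor_eqI_simple) (auto simp: is_hyp_mor_unit is_hyp_mor_Comp
        is_hyp_mor_N_R is_istr_mor_S_R simple_N_obj compose_def)
qed (simp add: is_hyp_mor_unit)

text \<open>With parallel incidences the selections made by \<open>inv_into\<close> would not be
  respected by arrows. Inside \<open>R_simple\<close> the common codomain \<open>y\<close> of the
  two composites is simple, which leaves no selection.\<close>

lemma nat_trans_counit:
  "nat_trans R_simple R_simple (N_R \<circ>\<^sub>F S_R \<circ>\<^sub>F id_functor) id_functor R_counit"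
  unfolding nat_trans_def
proof (intro conjI ballI allI impI)
  show "is_functor R_simple R_simple id_functor"
    by (intro is_functor_id category_full_subcategory category_R_cat)
  show "is_functor R_simple R_simple (N_R \<circ>\<^sub>F S_R \<circ>\<^sub>F id_functor)"
    by (rule is_functor_comp[OF is_functor_inclusion is_functor_N_S])
  fix x y f assume "f \<in> Hom (R_simple :: ('a hypergraph, 'a hyp_mor) cat) x y"
  then have f: "is_hyp_mor f" "hdom f = x" "hcod f = y" "is_hypergraph x" "is_hypergraph y"
    and s: "simple_hypergraph x" "simple_hypergraph y"
    by (auto simp: is_hyp_mor_def)
  show "Comp R_simple (R_counit y) (FArr (N_R \<circ>\<^sub>F S_R \<circ>\<^sub>F id_functor) f) =
      Comp R_simple (FArr id_functor f) (R_counit x)"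
    using f s unfolding full_subcategory_simps
    by (intro hyp_mor_eqI_simple) (auto simp: is_hyp_mor_counit is_hyp_mor_Comp
        is_hyp_mor_N_R is_istr_mor_S_R compose_def)
qed (auto simp: is_hyp_mor_counit simple_N_obj)

text \<open>The reflector is \<open>N_R \<circ>\<^sub>F S_R\<close>. Both triangle identities
  compare arrows into a simple hypergraph whose vertex and edge parts are restricted
  identities.\<close>

lemma reflective_simple: "reflective R_cat simple_hypergraph"
  unfolding reflective_def adjunction_def
proof (intro exI conjI ballI)
  fix x :: "'a hypergraph" assume "x \<in> Obj R_cat"
  then have x: "is_hypergraph x" "is_hypergraph (N_obj (S_obj x))"
    by (auto intro: is_hypergraph_N_S)
  show "Comp R_simple (R_counit (FObj (N_R \<circ>\<^sub>F S_R) x)) (FArr (N_R \<circ>\<^sub>F S_R) (R_unit x)) =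
      Ide R_simple (FObj (N_R \<circ>\<^sub>F S_R) x)"
    using x unfolding full_subcategory_simps
    by (intro hyp_mor_eqI_simple) (auto simp: is_hyp_mor_counit is_hyp_mor_unit is_hyp_mor_Comp
        is_hyp_mor_N_R is_istr_mor_S_R is_hyp_mor_Ide simple_N_obj compose_def)
next
  fix y :: "'a hypergraph" assume "y \<in> Obj R_simple"
  then have y: "is_hypergraph y" "simple_hypergraph y" by auto
  show "Comp R_cat (FArr id_functor (R_counit y)) (R_unit (FObj id_functor y)) =
      Ide R_cat (FObj id_functor y)"
    using y by (intro hyp_mor_eqI_simple) (auto simp: is_hyp_mor_counit is_hyp_mor_unit
        is_hyp_mor_Comp is_hyp_mor_Ide compose_def)
qed (use is_functor_N_S is_functor_inclusion nat_trans_unit nat_trans_counit in blast)+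

section \<open>Equivalence of incidence structures and simple hypergraphs\<close>

lemma iso_arr_Ide:
  assumes C: "category C" and x: "x \<in> Obj C"
  shows "iso_arr C (Ide C x)"
proof -
  have I: "Ide C x \<in> Hom C x x" using assms by (rule category_IdeI)
  moreover have "Comp C (Ide C x) (Ide C x) = Ide C x"
    using C I unfolding category_def by metis
  ultimately show ?thesis by (auto simp: iso_arr_def Hom_def)
qed

text \<open>The inverse is the unit at \<open>y\<close>: both round trips are the identity on
  vertices and edges, and both end in a simple hypergraph.\<close>

lemma iso_arr_counit:
  assumes "is_hypergraph y" "simple_hypergraph y"
  shows "iso_arr R_simple (R_counit y)"
  unfolding iso_arr_def
proof (intro conjI bexI[of _ "R_unit y"])
  show "R_counit y \<in> Arr R_simple"
    using assms by (simp add: full_subcategory_def is_hyp_mor_counit simple_N_obj)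
  show "R_unit y \<in> Hom R_simple (Cod R_simple (R_counit y)) (Dom R_simple (R_counit y))"
    using assms by (simp add: is_hyp_mor_unit simple_N_obj)
  show "Comp R_simple (R_unit y) (R_counit y) = Ide R_simple (Dom R_simple (R_counit y))"
    using assms unfolding full_subcategory_simps
    by (intro hyp_mor_eqI_simple) (auto simp: is_hyp_mor_counit is_hyp_mor_unit
        is_hyp_mor_Comp is_hyp_mor_Ide is_hypergraph_N_S simple_N_obj compose_def)
  show "Comp R_simple (R_counit y) (R_unit y) = Ide R_simple (Cod R_simple (R_counit y))"
    using assms unfolding full_subcategory_simps
    by (intro hyp_mor_eqI_simple) (auto simp: is_hyp_mor_counit is_hyp_mor_unit
        is_hyp_mor_Comp is_hyp_mor_Ide compose_def)
qed

text \<open>Because \<open>S_R\<close> undoes \<open>N_R\<close> strictly, identity arrows already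
  have the required source and target.\<close>

lemma nat_trans_Ide_S_N: "nat_trans IStr IStr id_functor (S_R \<circ>\<^sub>F N_R) (Ide IStr)"
  unfolding nat_trans_def
proof (intro conjI ballI allI impI)
  fix x y f assume f: "f \<in> Hom (IStr :: ('a inc_struct, 'a istr_mor) cat) x y"
  then have "Comp IStr (Ide IStr y) f = f \<and> Comp IStr f (Ide IStr x) = f"
    using category_IStr[unfolded category_def] by blast
  then show "Comp IStr (Ide IStr y) (FArr id_functor f) =
      Comp IStr (FArr (S_R \<circ>\<^sub>F N_R) f) (Ide IStr x)"
    by (simp add: S_R_N_R(2))
next
  fix x :: "'a inc_struct" assume "x \<in> Obj IStr"
  then show "Ide IStr x \<in> Hom IStr (FObj id_functor x) (FObj (S_R \<circ>\<^sub>F N_R) x)"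
    using category_IdeI[OF category_IStr, of x] by simp
qed (rule is_functor_id[OF category_IStr] is_functor_comp[OF is_functor_N_R is_functor_S_R])+

lemma equivalent_IStr_simple:
  "equivalent_categories (IStr :: ('a::universe inc_struct, 'a istr_mor) cat)
     (R_simple :: ('a hypergraph, 'a hyp_mor) cat)"
  unfolding equivalent_categories_def nat_iso_def
proof (intro exI conjI ballI)
  show F: "is_functor IStr R_simple N_R"
    by (rule is_functor_into_full[OF is_functor_N_R]) (simp add: simple_N_obj)
  show G: "is_functor R_simple IStr S_R"
    by (rule is_functor_from_full[OF is_functor_S_R])
  show "nat_trans IStr IStr id_functor (S_R \<circ>\<^sub>F N_R) (Ide IStr)"
    by (rule nat_trans_Ide_S_N)
  show "iso_arr IStr (Ide IStr x)" if "x \<in> Obj IStr" for x :: "'a inc_struct"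
    by (rule iso_arr_Ide[OF category_IStr that])
  show "nat_trans R_simple R_simple (N_R \<circ>\<^sub>F S_R) id_functor R_counit"
    \<comment> \<open>The reflection has the same counit; its source carries an extra
      \<open>id_functor\<close>, which disappears once the records are unfolded.\<close>
    using nat_trans_counit by (simp add: comp_functor_def id_functor_def comp_def)
  show "iso_arr R_simple (R_counit y)" if "y \<in> Obj R_simple" for y :: "'a hypergraph"
    using that by (simp add: iso_arr_counit)
qed

section \<open>Simplification of limits and colimits\<close>

text \<open>
  Ending the bundle in \<open>Defs\<close> left the name \<open>cone\<close> with the cardinal number of that name.
\<close>

hide_const (open) BNF_Cardinal_Arithmetic.cone

lemma S_R_Comp [simp]:
  assumes "is_hyp_mor f" "is_hyp_mor g" "hcod f = hdom g"
  shows "FArr S_R (Comp R_cat g f) = Comp IStr (FArr S_R g) (FArr S_R f)"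
  using is_functor_S_R[unfolded is_functor_def] assms by auto

lemma N_R_Comp:
  assumes "is_istr_mor f" "is_istr_mor g" "icod f = idom g"
  shows "FArr N_R (Comp IStr g f) = Comp R_cat (FArr N_R g) (FArr N_R f)"
  using is_functor_N_R[unfolded is_functor_def] assms by auto

lemma limit_cone_S_R:
  fixes D :: "('j, 'k, 'u::universe inc_struct, 'u istr_mor) fnctr"
  assumes D: "is_functor J IStr D" and lim: "limit_cone J R_cat (N_R \<circ>\<^sub>F D) X \<pi>"
  shows "limit_cone J IStr D (S_obj X) (\<lambda>j. FArr S_R (\<pi> j))"
proof -
  from lim have X: "is_hypergraph X"
    and \<pi>: "\<And>j. j \<in> Obj J \<Longrightarrow> is_hyp_mor (\<pi> j) \<and> hdom (\<pi> j) = X \<and> hcod (\<pi> j) = N_obj (FObj D j)"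
    and \<pi>_comm: "\<And>i j u. u \<in> Hom J i j \<Longrightarrow> Comp R_cat (FArr N_R (FArr D u)) (\<pi> i) = \<pi> j"
    and univ: "\<And>Y \<xi>. cone J R_cat (N_R \<circ>\<^sub>F D) Y \<xi> \<Longrightarrow>
        \<exists>!h. h \<in> Hom R_cat Y X \<and> (\<forall>j\<in>Obj J. Comp R_cat (\<pi> j) h = \<xi> j)"
    by (auto simp: limit_cone_def cone_def)
  have ND: "is_functor J R_cat (N_R \<circ>\<^sub>F D)"
    by (rule is_functor_comp[OF D is_functor_N_R])
  have J: "category J" using D by (simp add: is_functor_def)
  have Du: "is_istr_mor (FArr D u) \<and> idom (FArr D u) = FObj D i \<and> icod (FArr D u) = FObj D j"
    if "u \<in> Hom J i j" for u i j
    using D that by (auto simp: is_functor_def)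
  show ?thesis
    unfolding limit_cone_def
  proof (intro conjI allI impI)
    show "cone J IStr D (S_obj X) (\<lambda>j. FArr S_R (\<pi> j))"
      unfolding cone_def
    proof (intro conjI ballI allI impI)
      fix i j u assume u: "u \<in> Hom J i j"
      then have "i \<in> Obj J" "j \<in> Obj J" using category_Hom_Obj[OF J] by blast+
      then show "Comp IStr (FArr D u) (FArr S_R (\<pi> i)) = FArr S_R (\<pi> j)"
        using \<pi>_comm[OF u] \<pi>[of i] Du[OF u] S_R_Comp[of "\<pi> i" "FArr N_R (FArr D u)"]
        by (simp add: is_hyp_mor_N_R S_R_N_R(2))
    qed (use D X \<pi> in \<open>auto simp: is_inc_struct_S_obj is_istr_mor_S_R\<close>)
    fix Y \<xi> assume "cone J IStr D Y \<xi>"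
    then have Y: "is_inc_struct Y"
      and \<xi>: "\<And>j. j \<in> Obj J \<Longrightarrow> is_istr_mor (\<xi> j) \<and> idom (\<xi> j) = Y \<and> icod (\<xi> j) = FObj D j"
      and \<xi>_comm: "\<And>i j u. u \<in> Hom J i j \<Longrightarrow> Comp IStr (FArr D u) (\<xi> i) = \<xi> j"
      by (auto simp: cone_def)
    have "cone J R_cat (N_R \<circ>\<^sub>F D) (N_obj Y) (\<lambda>j. FArr N_R (\<xi> j))"
      unfolding cone_def
    proof (intro conjI ballI allI impI)
      fix i j u assume u: "u \<in> Hom J i j"
      then have "i \<in> Obj J" "j \<in> Obj J" using category_Hom_Obj[OF J] by blast+
      then show "Comp R_cat (FArr (N_R \<circ>\<^sub>F D) u) (FArr N_R (\<xi> i)) = FArr N_R (\<xi> j)"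
        using \<xi>_comm[OF u] \<xi>[of i] Du[OF u] N_R_Comp[of "\<xi> i" "FArr D u"] by simp
    qed (use ND Y \<xi> in \<open>auto simp: is_hypergraph_N_obj is_hyp_mor_N_R\<close>)
    from univ[OF this] obtain h
      where hH: "h \<in> Hom R_cat (N_obj Y) X"
        and h_comm: "\<And>j. j \<in> Obj J \<Longrightarrow> Comp R_cat (\<pi> j) h = FArr N_R (\<xi> j)"
        and h_unique: "\<And>h'. h' \<in> Hom R_cat (N_obj Y) X \<Longrightarrow>
          (\<forall>j\<in>Obj J. Comp R_cat (\<pi> j) h' = FArr N_R (\<xi> j)) \<Longrightarrow> h' = h"
      by (metis (lifting))
    from hH have h: "is_hyp_mor h" "hdom h = N_obj Y" "hcod h = X"
      by simp_all
    show "\<exists>!k. k \<in> Hom IStr Y (S_obj X) \<and> (\<forall>j\<in>Obj J. Comp IStr (FArr S_R (\<pi> j)) k = \<xi> j)"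
    proof (rule ex1I[of _ "FArr S_R h"], intro conjI ballI)
      show "FArr S_R h \<in> Hom IStr Y (S_obj X)"
        using h by (simp add: is_istr_mor_S_R)
      show "Comp IStr (FArr S_R (\<pi> j)) (FArr S_R h) = \<xi> j" if "j \<in> Obj J" for j
        using h \<pi>[OF that] h_comm[OF that] S_R_Comp[of h "\<pi> j"] by (simp add: S_R_N_R(2))
      fix k assume k: "k \<in> Hom IStr Y (S_obj X) \<and>
        (\<forall>j\<in>Obj J. Comp IStr (FArr S_R (\<pi> j)) k = \<xi> j)"
      \<comment> \<open>Since \<open>S_obj (N_obj Y) = Y\<close>, the arrow \<open>k\<close> runs
        between simplifications and fullness applies. The lift involves choices, but the universal
        property of \<open>X\<close> forces every such lift to be \<open>h\<close>.\<close>
      then obtain h' where h': "is_hyp_mor h'" "hdom h' = N_obj Y" "hcod h' = X" "FArr S_R h' = k"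
        using S_R_full[of k "N_obj Y" X] X Y by (auto simp: is_hypergraph_N_obj)
      \<comment> \<open>The codomain \<open>N_obj (FObj D j)\<close> is simple, so the equation may
        be checked after \<open>S_R\<close>, where it is the assumption on \<open>k\<close>.\<close>
      have "Comp R_cat (\<pi> j) h' = FArr N_R (\<xi> j)" if j: "j \<in> Obj J" for j
      proof (rule S_R_faithful_into_simple)
        show "FArr S_R (Comp R_cat (\<pi> j) h') = FArr S_R (FArr N_R (\<xi> j))"
          using h' \<pi>[OF j] k j by (simp add: S_R_N_R(2))
      qed (use h' \<pi>[OF j] \<xi>[OF j] in
          \<open>auto simp: is_hyp_mor_Comp is_hyp_mor_N_R simple_N_obj\<close>)
      then have "h' = h"
        using h' by (intro h_unique) auto
      then show "k = FArr S_R h" using h' by simp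
    qed
  qed
qed

lemma colimit_cocone_S_R:
  fixes D :: "('j, 'k, 'u::universe inc_struct, 'u istr_mor) fnctr"
  assumes D: "is_functor J IStr D" and colim: "colimit_cocone J R_cat (N_R \<circ>\<^sub>F D) X \<iota>"
  shows "colimit_cocone J IStr D (S_obj X) (\<lambda>j. FArr S_R (\<iota> j))"
proof -
  from colim have X: "is_hypergraph X"
    and \<iota>: "\<And>j. j \<in> Obj J \<Longrightarrow> is_hyp_mor (\<iota> j) \<and> hdom (\<iota> j) = N_obj (FObj D j) \<and> hcod (\<iota> j) = X"
    and \<iota>_comm: "\<And>i j u. u \<in> Hom J i j \<Longrightarrow> Comp R_cat (\<iota> j) (FArr N_R (FArr D u)) = \<iota> i"
    and univ: "\<And>Y \<xi>. cocone J R_cat (N_R \<circ>\<^sub>F D) Y \<xi> \<Longrightarrow>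
        \<exists>!h. h \<in> Hom R_cat X Y \<and> (\<forall>j\<in>Obj J. Comp R_cat h (\<iota> j) = \<xi> j)"
    by (auto simp: colimit_cocone_def cocone_def)
  have ND: "is_functor J R_cat (N_R \<circ>\<^sub>F D)"
    by (rule is_functor_comp[OF D is_functor_N_R])
  have J: "category J" using D by (simp add: is_functor_def)
  have Du: "is_istr_mor (FArr D u) \<and> idom (FArr D u) = FObj D i \<and> icod (FArr D u) = FObj D j"
    if "u \<in> Hom J i j" for u i j
    using D that by (auto simp: is_functor_def)
  show ?thesis
    unfolding colimit_cocone_def
  proof (intro conjI allI impI)
    show "cocone J IStr D (S_obj X) (\<lambda>j. FArr S_R (\<iota> j))"
      unfolding cocone_def
    proof (intro conjI ballI allI impI)
      fix i j u assume u: "u \<in> Hom J i j"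
      then have "i \<in> Obj J" "j \<in> Obj J" using category_Hom_Obj[OF J] by blast+
      then show "Comp IStr (FArr S_R (\<iota> j)) (FArr D u) = FArr S_R (\<iota> i)"
        using \<iota>_comm[OF u] \<iota>[of j] Du[OF u] S_R_Comp[of "FArr N_R (FArr D u)" "\<iota> j"]
        by (simp add: is_hyp_mor_N_R S_R_N_R(2))
    qed (use D X \<iota> in \<open>auto simp: is_inc_struct_S_obj is_istr_mor_S_R\<close>)
    fix Y \<xi> assume "cocone J IStr D Y \<xi>"
    then have Y: "is_inc_struct Y"
      and \<xi>: "\<And>j. j \<in> Obj J \<Longrightarrow> is_istr_mor (\<xi> j) \<and> idom (\<xi> j) = FObj D j \<and> icod (\<xi> j) = Y"
      and \<xi>_comm: "\<And>i j u. u \<in> Hom J i j \<Longrightarrow> Comp IStr (\<xi> j) (FArr D u) = \<xi> i"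
      by (auto simp: cocone_def)
    have "cocone J R_cat (N_R \<circ>\<^sub>F D) (N_obj Y) (\<lambda>j. FArr N_R (\<xi> j))"
      unfolding cocone_def
    proof (intro conjI ballI allI impI)
      fix i j u assume u: "u \<in> Hom J i j"
      then have "i \<in> Obj J" "j \<in> Obj J" using category_Hom_Obj[OF J] by blast+
      then show "Comp R_cat (FArr N_R (\<xi> j)) (FArr (N_R \<circ>\<^sub>F D) u) = FArr N_R (\<xi> i)"
        using \<xi>_comm[OF u] \<xi>[of j] Du[OF u] N_R_Comp[of "FArr D u" "\<xi> j"] by simp
    qed (use ND Y \<xi> in \<open>auto simp: is_hypergraph_N_obj is_hyp_mor_N_R\<close>)
    from univ[OF this] obtain h
      where hH: "h \<in> Hom R_cat X (N_obj Y)"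
        and h_comm: "\<And>j. j \<in> Obj J \<Longrightarrow> Comp R_cat h (\<iota> j) = FArr N_R (\<xi> j)"
        and h_unique: "\<And>h'. h' \<in> Hom R_cat X (N_obj Y) \<Longrightarrow>
          (\<forall>j\<in>Obj J. Comp R_cat h' (\<iota> j) = FArr N_R (\<xi> j)) \<Longrightarrow> h' = h"
      by (metis (lifting))
    from hH have h: "is_hyp_mor h" "hdom h = X" "hcod h = N_obj Y"
      by simp_all
    show "\<exists>!k. k \<in> Hom IStr (S_obj X) Y \<and> (\<forall>j\<in>Obj J. Comp IStr k (FArr S_R (\<iota> j)) = \<xi> j)"
    proof (rule ex1I[of _ "FArr S_R h"], intro conjI ballI)
      show "FArr S_R h \<in> Hom IStr (S_obj X) Y"
        using h by (simp add: is_istr_mor_S_R)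
      show "Comp IStr (FArr S_R h) (FArr S_R (\<iota> j)) = \<xi> j" if "j \<in> Obj J" for j
        using h \<iota>[OF that] h_comm[OF that] S_R_Comp[of "\<iota> j" h] by (simp add: S_R_N_R(2))
      fix k assume k: "k \<in> Hom IStr (S_obj X) Y \<and>
        (\<forall>j\<in>Obj J. Comp IStr k (FArr S_R (\<iota> j)) = \<xi> j)"
      then obtain h' where h': "is_hyp_mor h'" "hdom h' = X" "hcod h' = N_obj Y" "FArr S_R h' = k"
        using S_R_full[of k X "N_obj Y"] X Y by (auto simp: is_hypergraph_N_obj)
      \<comment> \<open>Here the simple codomain is \<open>N_obj Y\<close>, the target of the lift
        itself, in contrast to limits, where it is an object of the diagram.\<close>
      have "Comp R_cat h' (\<iota> j) = FArr N_R (\<xi> j)" if j: "j \<in> Obj J" for j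
      proof (rule S_R_faithful_into_simple)
        show "FArr S_R (Comp R_cat h' (\<iota> j)) = FArr S_R (FArr N_R (\<xi> j))"
          using h' \<iota>[OF j] k j by (simp add: S_R_N_R(2))
      qed (use h' \<iota>[OF j] \<xi>[OF j] in
          \<open>auto simp: is_hyp_mor_Comp is_hyp_mor_N_R simple_N_obj\<close>)
      then have "h' = h"
        using h' by (intro h_unique) auto
      then show "k = FArr S_R h" using h' by simp
    qed
  qed
qed

section \<open>Limits and colimits of small sets\<close>

text \<open>
  A function is coded by its graph, a subset of a small set \<open>A\<close>, and \<open>Pow A\<close> injects into the
  universe by \<open>small_Pow\<close>.
\<close>

lemma small_function_space:
  fixes V :: "'u::universe \<Rightarrow> 'u set"
  assumes S: "small (S :: 'u set)" and V: "\<And>j. j \<in> S \<Longrightarrow> small (V j)"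
  obtains code :: "('u \<Rightarrow> 'u) \<Rightarrow> 'u"
  where "inj_on code (PiE S V)" "small (code ` PiE S V)"
proof -
  define A where "A = (\<Union>j\<in>S. upair j ` V j)"
  define gr where "gr = (\<lambda>x :: 'u \<Rightarrow> 'u. (\<lambda>j. upair j (x j)) ` S)"
  have "small A"
    unfolding A_def by (intro small_UN small_image S V)
  then have Pow: "(card_of (Pow A), card_of (UNIV :: 'u set)) \<in> ordLess"
    by (rule small_Pow)
  then have "(card_of (Pow A), card_of (UNIV :: 'u set)) \<in> ordLeq"
    by (rule ordLess_imp_ordLeq)
  then obtain c :: "'u set \<Rightarrow> 'u" where c: "inj_on c (Pow A)"
    unfolding card_of_ordLeq[symmetric] by blast
  have gr_Pow: "gr ` PiE S V \<subseteq> Pow A"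
    by (auto simp: gr_def A_def)
  have gr_inj: "inj_on gr (PiE S V)"
  proof (rule inj_onI)
    fix x y assume x: "x \<in> PiE S V" and y: "y \<in> PiE S V" and eq: "gr x = gr y"
    have "x j = y j" if "j \<in> S" for j
    proof -
      have "upair j (x j) \<in> gr y" using eq that unfolding gr_def by blast
      then show ?thesis by (auto simp: gr_def upair_inject)
    qed
    then show "x = y" using x y by (meson PiE_ext)
  qed
  show ?thesis
  proof (rule that[of "c \<circ> gr"])
    show "inj_on (c \<circ> gr) (PiE S V)"
      using comp_inj_on[OF gr_inj] inj_on_subset[OF c gr_Pow] by blast
    \<comment> \<open>Smallness is a strict bound, which injectivity of \<open>c\<close> alone does
      not give; the bound on \<open>Pow A\<close> is passed on to its image.\<close>
    have "(card_of (c ` Pow A), card_of (UNIV :: 'u set)) \<in> ordLess"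
      using ordLeq_ordLess_trans[OF card_of_image Pow] .
    then have "small (c ` Pow A)" by (simp add: small_def)
    then show "small ((c \<circ> gr) ` PiE S V)"
      by (rule small_subset) (use gr_Pow in auto)
  qed
qed

text \<open>The limit of the sets \<open>V j\<close> along the maps \<open>a u\<close>, described by
  elements: compatible families correspond to exactly one point of \<open>L\<close>. Mediating maps
  then arise by choosing a point for each argument, and joint injectivity of the projections gives
  their uniqueness.\<close>

definition set_limit ::
  "('j, 'k) cat \<Rightarrow> ('j \<Rightarrow> 'u set) \<Rightarrow> ('k \<Rightarrow> 'u \<Rightarrow> 'u) \<Rightarrow> 'u set \<Rightarrow> ('j \<Rightarrow> 'u \<Rightarrow> 'u) \<Rightarrow> bool" where
  "set_limit J V a L p \<longleftrightarrow>
     (\<forall>j\<in>Obj J. \<forall>l\<in>L. p j l \<in> V j) \<and>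
     (\<forall>i j u. u \<in> Hom J i j \<longrightarrow> (\<forall>l\<in>L. a u (p i l) = p j l)) \<and>
     (\<forall>x. (\<forall>j\<in>Obj J. x j \<in> V j) \<and> (\<forall>i j u. u \<in> Hom J i j \<longrightarrow> a u (x i) = x j) \<longrightarrow>
        (\<exists>l\<in>L. \<forall>j\<in>Obj J. p j l = x j)) \<and>
     (\<forall>l\<in>L. \<forall>l'\<in>L. (\<forall>j\<in>Obj J. p j l = p j l') \<longrightarrow> l = l')"

lemma set_limitD:
  assumes "set_limit J V a L p"
  shows "\<And>j l. j \<in> Obj J \<Longrightarrow> l \<in> L \<Longrightarrow> p j l \<in> V j"
    and "\<And>i j u l. u \<in> Hom J i j \<Longrightarrow> l \<in> L \<Longrightarrow> a u (p i l) = p j l"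
    and "\<And>x. (\<And>j. j \<in> Obj J \<Longrightarrow> x j \<in> V j) \<Longrightarrow> (\<And>i j u. u \<in> Hom J i j \<Longrightarrow> a u (x i) = x j) \<Longrightarrow>
       \<exists>l\<in>L. \<forall>j\<in>Obj J. p j l = x j"
    and "\<And>l l'. l \<in> L \<Longrightarrow> l' \<in> L \<Longrightarrow> (\<And>j. j \<in> Obj J \<Longrightarrow> p j l = p j l') \<Longrightarrow> l = l'"
  using assms unfolding set_limit_def by blast+

text \<open>The usual set of compatible families, moved into the universe by \<open>code\<close>;
  \<open>p\<close> decodes a family and evaluates it.\<close>

lemma small_set_limit:
  fixes J :: "('u::universe, 'u) cat" and V :: "'u \<Rightarrow> 'u set" and a :: "'u \<Rightarrow> 'u \<Rightarrow> 'u"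
  assumes J: "small_category J" and V: "\<And>j. j \<in> Obj J \<Longrightarrow> small (V j)"
  shows "\<exists>L p. small L \<and> set_limit J V a L p"
proof -
  let ?P = "PiE (Obj J) V"
  have S: "small (Obj J)" and cat: "category J"
    using J by (auto simp: small_category_def)
  obtain code :: "('u \<Rightarrow> 'u) \<Rightarrow> 'u" where inj: "inj_on code ?P" and small: "small (code ` ?P)"
    using small_function_space[of "Obj J" V] S V by blast
  define M where "M = {x \<in> ?P. \<forall>i j u. u \<in> Hom J i j \<longrightarrow> a u (x i) = x j}"
  define p where "p = (\<lambda>j l. inv_into ?P code l j)"
  have p: "p j (code x) = x j" if "x \<in> M" for x j
    using that inj by (simp add: p_def M_def)
  have "set_limit J V a (code ` M) p"
    unfolding set_limit_def
  proof (intro conjI ballI allI impI; (elim conjE)?)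
    show "p j l \<in> V j" if "j \<in> Obj J" "l \<in> code ` M" for j l
      using that p by (auto simp: M_def)
    show "a u (p i l) = p j l" if "u \<in> Hom J i j" "l \<in> code ` M" for i j u l
      using that p by (auto simp: M_def)
    show "\<exists>l\<in>code ` M. \<forall>j\<in>Obj J. p j l = x j"
      if x: "\<forall>j\<in>Obj J. x j \<in> V j" "\<forall>i j u. u \<in> Hom J i j \<longrightarrow> a u (x i) = x j" for x
    proof
      \<comment> \<open>\<open>x\<close> is arbitrary outside \<open>Obj J\<close>, while
        \<open>code\<close> is injective only on extensional families. Restricting keeps the
        compatibility equations, whose indices are ends of arrows of \<open>J\<close>.\<close>
      have "restrict x (Obj J) \<in> M"
        using x category_Hom_Obj[OF cat] by (fastforce simp: M_def)
      then show "code (restrict x (Obj J)) \<in> code ` M"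
        and "\<forall>j\<in>Obj J. p j (code (restrict x (Obj J))) = x j"
        by (simp_all add: p)
    qed
    show "l = l'" if l: "l \<in> code ` M" "l' \<in> code ` M"
      and eq: "\<forall>j\<in>Obj J. p j l = p j l'" for l l'
    proof -
      obtain x y where x: "x \<in> M" "l = code x" and y: "y \<in> M" "l' = code y"
        using l by blast
      have "x j = y j" if "j \<in> Obj J" for j
        using eq that x y by (simp add: p)
      then have "x = y"
        using x(1) y(1) PiE_ext[of x "Obj J" V y] by (auto simp: M_def)
      then show ?thesis using x y by simp
    qed
  qed
  moreover have "small (code ` M)"
    by (rule small_subset[OF small]) (auto simp: M_def)
  ultimately show ?thesis by blast
qed

text \<open>Factorization is demanded only for families with values in \<open>'u\<close>, since HOL
  cannot quantify over types here. Uniqueness and range of the factoring map \<open>h\<close> are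
  not mentioned: both follow on \<open>C\<close> from the clause that the images of the
  \<open>q j\<close> cover it.\<close>

definition set_colimit ::
  "('j, 'k) cat \<Rightarrow> ('j \<Rightarrow> 'u set) \<Rightarrow> ('k \<Rightarrow> 'u \<Rightarrow> 'u) \<Rightarrow> 'u set \<Rightarrow> ('j \<Rightarrow> 'u \<Rightarrow> 'u) \<Rightarrow> bool" where
  "set_colimit J V a C q \<longleftrightarrow>
     (\<forall>j\<in>Obj J. \<forall>x\<in>V j. q j x \<in> C) \<and>
     (\<forall>c\<in>C. \<exists>j\<in>Obj J. \<exists>x\<in>V j. c = q j x) \<and>
     (\<forall>i j u. u \<in> Hom J i j \<longrightarrow> (\<forall>x\<in>V i. q j (a u x) = q i x)) \<and>
     (\<forall>f :: 'j \<Rightarrow> 'u \<Rightarrow> 'u. (\<forall>i j u. u \<in> Hom J i j \<longrightarrow> (\<forall>x\<in>V i. f j (a u x) = f i x)) \<longrightarrow>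
        (\<exists>h. \<forall>j\<in>Obj J. \<forall>x\<in>V j. h (q j x) = f j x))"

lemma set_colimitD:
  fixes V :: "'j \<Rightarrow> 'u set"
  assumes "set_colimit J V a C q"
  shows "\<And>j x. j \<in> Obj J \<Longrightarrow> x \<in> V j \<Longrightarrow> q j x \<in> C"
    and "\<And>c. c \<in> C \<Longrightarrow> \<exists>j\<in>Obj J. \<exists>x\<in>V j. c = q j x"
    and "\<And>i j u x. u \<in> Hom J i j \<Longrightarrow> x \<in> V i \<Longrightarrow> q j (a u x) = q i x"
    and "\<And>f :: 'j \<Rightarrow> 'u \<Rightarrow> 'u. (\<And>i j u x. u \<in> Hom J i j \<Longrightarrow> x \<in> V i \<Longrightarrow> f j (a u x) = f i x) \<Longrightarrow>
       \<exists>h. \<forall>j\<in>Obj J. \<forall>x\<in>V j. h (q j x) = f j x"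
  using assms unfolding set_colimit_def by blast+

text \<open>
  The colimit is the quotient of the disjoint union by the relation that all compatible families
  (with values in the universe) agree; this avoids generating an equivalence relation.
\<close>

lemma small_set_colimit:
  fixes J :: "('u::universe, 'u) cat" and V :: "'u \<Rightarrow> 'u set" and a :: "'u \<Rightarrow> 'u \<Rightarrow> 'u"
  assumes J: "small_category J" and V: "\<And>j. j \<in> Obj J \<Longrightarrow> small (V j)"
  shows "\<exists>C q. small C \<and> set_colimit J V a C q"
proof -
  define F where "F = {f :: 'u \<Rightarrow> 'u \<Rightarrow> 'u. \<forall>i j u x. u \<in> Hom J i j \<and> x \<in> V i \<longrightarrow> f j (a u x) = f i x}"
  define agree where "agree = (\<lambda>w z. \<forall>f\<in>F. f (ufst w) (usnd w) = f (ufst z) (usnd z))"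
  \<comment> \<open>A class is a set, not an element of the universe, so a chosen member stands for
    it. The member may lie outside \<open>W\<close>; it only has to agree with \<open>z\<close>
    under all compatible families.\<close>
  define cls where "cls = (\<lambda>z. SOME w. agree w z)"
  define W where "W = (\<Union>j\<in>Obj J. upair j ` V j)"
  have agree_cls: "agree (cls z) z" for z
    unfolding cls_def by (rule someI[of _ z]) (simp add: agree_def)
  have cls_eq: "cls z = cls z'" if "agree z z'" for z z'
  proof -
    have "agree w z = agree w z'" for w
      using that by (auto simp: agree_def)
    then show ?thesis by (simp add: cls_def)
  qed
  have "set_colimit J V a (cls ` W) (\<lambda>j x. cls (upair j x))"
    unfolding set_colimit_def
  proof (intro conjI ballI allI impI)
    show "cls (upair j x) \<in> cls ` W" if "j \<in> Obj J" "x \<in> V j" for j x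
      using that by (auto simp: W_def)
    show "\<exists>j\<in>Obj J. \<exists>x\<in>V j. c = cls (upair j x)" if "c \<in> cls ` W" for c
      using that by (auto simp: W_def)
    show "cls (upair j (a u x)) = cls (upair i x)" if "u \<in> Hom J i j" "x \<in> V i" for i j u x
      using that by (intro cls_eq) (auto simp: agree_def F_def)
    show "\<exists>h. \<forall>j\<in>Obj J. \<forall>x\<in>V j. h (cls (upair j x)) = f j x"
      if "\<forall>i j u. u \<in> Hom J i j \<longrightarrow> (\<forall>x\<in>V i. f j (a u x) = f i x)" for f :: "'u \<Rightarrow> 'u \<Rightarrow> 'u"
    proof (intro exI ballI)
      fix j x
      have "f \<in> F" using that by (auto simp: F_def)
      \<comment> \<open>The witness for \<open>h\<close> evaluates \<open>f\<close> at the
        representative: it is \<open>\<lambda>c. f (ufst c) (usnd c)\<close>.\<close>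
      then show "f (ufst (cls (upair j x))) (usnd (cls (upair j x))) = f j x"
        using agree_cls[of "upair j x"] by (simp add: agree_def)
    qed
  qed
  moreover have "small (cls ` W)"
    using J V by (auto simp: W_def small_category_def intro!: small_UN small_image)
  ultimately show ?thesis by blast
qed

section \<open>Limits and colimits of incidence hypergraphs\<close>

lemma hyp_diagram_simps:
  assumes D: "is_functor J R_cat D"
  shows "j \<in> Obj J \<Longrightarrow> is_hypergraph (FObj D j)"
    and "u \<in> Hom J i j \<Longrightarrow> i \<in> Obj J \<and> j \<in> Obj J \<and> is_hyp_mor (FArr D u) \<and>
      hdom (FArr D u) = FObj D i \<and> hcod (FArr D u) = FObj D j"
  using D category_Hom_Obj[of J u i j] by (auto simp: is_functor_def)

lemma hyp_mor_inc:
  assumes "is_hyp_mor f" "x \<in> incs (hdom f)"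
  shows "imap f x \<in> incs (hcod f)"
    "inc_vert (hcod f) (imap f x) = vmap f (inc_vert (hdom f) x)"
    "inc_edge (hcod f) (imap f x) = emap f (inc_edge (hdom f) x)"
  using assms by (auto simp: is_hyp_mor_def)

lemma hypergraph_inc:
  assumes "is_hypergraph G" "x \<in> incs G"
  shows "inc_vert G x \<in> verts G" "inc_edge G x \<in> edges G"
  using assms by (auto simp: is_hypergraph_def)

lemma Comp_R_eqD:
  assumes "Comp R_cat g f = h"
  shows "v \<in> verts (hdom f) \<Longrightarrow> vmap g (vmap f v) = vmap h v"
    and "e \<in> edges (hdom f) \<Longrightarrow> emap g (emap f e) = emap h e"
    and "i \<in> incs (hdom f) \<Longrightarrow> imap g (imap f i) = imap h i"
  using assms[symmetric] by (simp_all add: compose_def)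

lemma R_cat_has_limits:
  fixes J :: "('u::universe, 'u) cat" and D :: "('u, 'u, 'u hypergraph, 'u hyp_mor) fnctr"
  assumes J: "small_category J" and D: "is_functor J R_cat D"
  shows "\<exists>X \<pi>. limit_cone J R_cat D X \<pi>"
proof -
  note Dobj = hyp_diagram_simps(1)[OF D] and Darr = hyp_diagram_simps(2)[OF D]
  have small: "small (verts (FObj D j))" "small (edges (FObj D j))" "small (incs (FObj D j))"
    if "j \<in> Obj J" for j
    using Dobj[OF that] by (auto simp: is_hypergraph_def)
  obtain Lv pv where small_Lv: "small Lv"
    and "set_limit J (\<lambda>j. verts (FObj D j)) (\<lambda>u. vmap (FArr D u)) Lv pv"
    using small_set_limit[OF J, where V = "\<lambda>j. verts (FObj D j)" and
        a = "\<lambda>u. vmap (FArr D u)"] small by blast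
  note Lv = set_limitD(1,2)[OF this(2)] and Lv_ex = set_limitD(3)[OF this(2)]
    and Lv_eq = set_limitD(4)[OF this(2)]
  obtain Le pe where small_Le: "small Le"
    and "set_limit J (\<lambda>j. edges (FObj D j)) (\<lambda>u. emap (FArr D u)) Le pe"
    using small_set_limit[OF J, where V = "\<lambda>j. edges (FObj D j)" and
        a = "\<lambda>u. emap (FArr D u)"] small by blast
  note Le = set_limitD(1,2)[OF this(2)] and Le_ex = set_limitD(3)[OF this(2)]
    and Le_eq = set_limitD(4)[OF this(2)]
  obtain Li p where small_Li: "small Li"
    and "set_limit J (\<lambda>j. incs (FObj D j)) (\<lambda>u. imap (FArr D u)) Li p"
    using small_set_limit[OF J, where V = "\<lambda>j. incs (FObj D j)" and
        a = "\<lambda>u. imap (FArr D u)"] small by blast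
  note Li = set_limitD(1,2)[OF this(2)] and Li_ex = set_limitD(3)[OF this(2)]
    and Li_eq = set_limitD(4)[OF this(2)]
  have inc_comm: "vmap (FArr D u) (inc_vert (FObj D i) (p i l)) = inc_vert (FObj D j) (p j l)"
    "emap (FArr D u) (inc_edge (FObj D i) (p i l)) = inc_edge (FObj D j) (p j l)"
    if "u \<in> Hom J i j" "l \<in> Li" for i j u l
    using Darr[OF that(1)] that Li(1)[of i l] Li(2)[of u i j l] hyp_mor_inc[of "FArr D u" "p i l"]
    by auto
  \<comment> \<open>The ends of a compatible family of incidences form a compatible family of
    vertices, hence one point of \<open>Lv\<close>. This is the map induced between the limits;
    \<open>se\<close> arises in the same way.\<close>
  have "\<forall>l\<in>Li. \<exists>v\<in>Lv. \<forall>j\<in>Obj J. pv j v = inc_vert (FObj D j) (p j l)"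
    using inc_comm Li Dobj by (intro ballI Lv_ex) (auto intro: hypergraph_inc)
  then obtain sv where sv: "\<And>l. l \<in> Li \<Longrightarrow> sv l \<in> Lv"
    "\<And>l j. l \<in> Li \<Longrightarrow> j \<in> Obj J \<Longrightarrow> pv j (sv l) = inc_vert (FObj D j) (p j l)"
    by (metis (no_types, lifting))
  have "\<forall>l\<in>Li. \<exists>e\<in>Le. \<forall>j\<in>Obj J. pe j e = inc_edge (FObj D j) (p j l)"
    using inc_comm Li Dobj by (intro ballI Le_ex) (auto intro: hypergraph_inc)
  then obtain se where se: "\<And>l. l \<in> Li \<Longrightarrow> se l \<in> Le"
    "\<And>l j. l \<in> Li \<Longrightarrow> j \<in> Obj J \<Longrightarrow> pe j (se l) = inc_edge (FObj D j) (p j l)"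
    by (metis (no_types, lifting))
  define X where "X = \<lparr>verts = Lv, edges = Le, incs = Li, inc_vert = restrict sv Li,
    inc_edge = restrict se Li\<rparr>"
  define \<pi> where "\<pi> = (\<lambda>j. \<lparr>hdom = X, hcod = FObj D j, vmap = restrict (pv j) Lv,
    emap = restrict (pe j) Le, imap = restrict (p j) Li\<rparr>)"
  have X: "is_hypergraph X"
    using small_Lv small_Le small_Li sv(1) se(1) by (auto simp: is_hypergraph_def X_def)
  have X_simps: "verts X = Lv" "edges X = Le" "incs X = Li"
    "\<And>l. l \<in> Li \<Longrightarrow> inc_vert X l = sv l" "\<And>l. l \<in> Li \<Longrightarrow> inc_edge X l = se l"
    by (simp_all add: X_def)
  have \<pi>_simps: "hdom (\<pi> j) = X" "hcod (\<pi> j) = FObj D j"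
    "vmap (\<pi> j) = restrict (pv j) Lv" "emap (\<pi> j) = restrict (pe j) Le"
    "imap (\<pi> j) = restrict (p j) Li" for j
    by (simp_all add: \<pi>_def)
  have \<pi>: "is_hyp_mor (\<pi> j)" if "j \<in> Obj J" for j
    using that X Dobj Lv(1) Le(1) Li(1) sv se by (auto simp: is_hyp_mor_def \<pi>_simps X_simps)
  have "cone J R_cat D X \<pi>"
    unfolding cone_def
  proof (intro conjI ballI allI impI)
    fix i j u assume u: "u \<in> Hom J i j"
    show "Comp R_cat (FArr D u) (\<pi> i) = \<pi> j"
      using Darr[OF u] \<pi>[of i] \<pi>[of j] Lv(2)[OF u] Le(2)[OF u] Li(2)[OF u]
      by (intro hyp_mor_eqI) (auto simp: is_hyp_mor_Comp \<pi>_simps X_simps compose_def)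
  qed (use D X \<pi> in \<open>auto simp: \<pi>_simps\<close>)
  moreover have "\<exists>!h. h \<in> Hom R_cat Y X \<and> (\<forall>j\<in>Obj J. Comp R_cat (\<pi> j) h = \<xi> j)"
    if "cone J R_cat D Y \<xi>" for Y \<xi>
  proof -
    from that have Y: "is_hypergraph Y"
      and \<xi>: "\<And>j. j \<in> Obj J \<Longrightarrow> is_hyp_mor (\<xi> j) \<and> hdom (\<xi> j) = Y \<and> hcod (\<xi> j) = FObj D j"
      and \<xi>_comm: "\<And>i j u. u \<in> Hom J i j \<Longrightarrow> Comp R_cat (FArr D u) (\<xi> i) = \<xi> j"
      by (auto simp: cone_def)
    have \<xi>_mem: "v \<in> verts Y \<Longrightarrow> vmap (\<xi> j) v \<in> verts (FObj D j)"
      "e \<in> edges Y \<Longrightarrow> emap (\<xi> j) e \<in> edges (FObj D j)"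
      "i \<in> incs Y \<Longrightarrow> imap (\<xi> j) i \<in> incs (FObj D j)" if "j \<in> Obj J" for j v e i
      using \<xi>[OF that] by (auto simp: is_hyp_mor_def)
    have \<xi>_eq: "v \<in> verts Y \<Longrightarrow> vmap (FArr D u) (vmap (\<xi> i) v) = vmap (\<xi> j) v"
      "e \<in> edges Y \<Longrightarrow> emap (FArr D u) (emap (\<xi> i) e) = emap (\<xi> j) e"
      "k \<in> incs Y \<Longrightarrow> imap (FArr D u) (imap (\<xi> i) k) = imap (\<xi> j) k"
      if "u \<in> Hom J i j" for i j u v e k
      using Comp_R_eqD[OF \<xi>_comm[OF that]] \<xi>[of i] Darr[OF that] by auto
    have "\<forall>v\<in>verts Y. \<exists>l\<in>Lv. \<forall>j\<in>Obj J. pv j l = vmap (\<xi> j) v"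
      using \<xi>_mem \<xi>_eq by (intro ballI Lv_ex) auto
    then obtain hv where hv: "\<And>v. v \<in> verts Y \<Longrightarrow> hv v \<in> Lv"
      "\<And>v j. v \<in> verts Y \<Longrightarrow> j \<in> Obj J \<Longrightarrow> pv j (hv v) = vmap (\<xi> j) v"
      by (metis (no_types, lifting))
    have "\<forall>e\<in>edges Y. \<exists>l\<in>Le. \<forall>j\<in>Obj J. pe j l = emap (\<xi> j) e"
      using \<xi>_mem \<xi>_eq by (intro ballI Le_ex) auto
    then obtain he where he: "\<And>e. e \<in> edges Y \<Longrightarrow> he e \<in> Le"
      "\<And>e j. e \<in> edges Y \<Longrightarrow> j \<in> Obj J \<Longrightarrow> pe j (he e) = emap (\<xi> j) e"
      by (metis (no_types, lifting))
    have "\<forall>i\<in>incs Y. \<exists>l\<in>Li. \<forall>j\<in>Obj J. p j l = imap (\<xi> j) i"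
      using \<xi>_mem \<xi>_eq by (intro ballI Li_ex) auto
    then obtain hi where hi: "\<And>i. i \<in> incs Y \<Longrightarrow> hi i \<in> Li"
      "\<And>i j. i \<in> incs Y \<Longrightarrow> j \<in> Obj J \<Longrightarrow> p j (hi i) = imap (\<xi> j) i"
      by (metis (no_types, lifting))
    define h where "h = \<lparr>hdom = Y, hcod = X, vmap = restrict hv (verts Y),
      emap = restrict he (edges Y), imap = restrict hi (incs Y)\<rparr>"
    have h_simps: "hdom h = Y" "hcod h = X" "vmap h = restrict hv (verts Y)"
      "emap h = restrict he (edges Y)" "imap h = restrict hi (incs Y)"
      by (simp_all add: h_def)
    \<comment> \<open>Joint injectivity reduces this to each projection, where it says that
      \<open>\<xi> j\<close> respects ends.\<close>
    have "sv (hi i) = hv (inc_vert Y i) \<and> se (hi i) = he (inc_edge Y i)" if i: "i \<in> incs Y" for i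
    proof -
      note ends = hypergraph_inc[OF Y i]
      have inc: "inc_vert (FObj D j) (imap (\<xi> j) i) = vmap (\<xi> j) (inc_vert Y i)"
        "inc_edge (FObj D j) (imap (\<xi> j) i) = emap (\<xi> j) (inc_edge Y i)" if "j \<in> Obj J" for j
        using hyp_mor_inc[of "\<xi> j" i] \<xi>[OF that] i by auto
      show ?thesis
        by (rule conjI[OF Lv_eq Le_eq]) (simp_all add: inc ends i sv se hv he hi)
    qed
    then have h: "is_hyp_mor h"
      using X Y hv he hi hypergraph_inc[OF Y] by (auto simp: is_hyp_mor_def h_simps X_simps)
    show ?thesis
    proof (rule ex1I[of _ h], intro conjI ballI)
      show "h \<in> Hom R_cat Y X" using h h_simps by simp
      show "Comp R_cat (\<pi> j) h = \<xi> j" if "j \<in> Obj J" for j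
        using \<xi>[OF that] \<pi>[OF that] h that hv he hi
        by (intro hyp_mor_eqI) (auto simp: is_hyp_mor_Comp \<pi>_simps h_simps X_simps compose_def)
      fix k assume "k \<in> Hom R_cat Y X \<and> (\<forall>j\<in>Obj J. Comp R_cat (\<pi> j) k = \<xi> j)"
      then have k: "is_hyp_mor k" "hdom k = Y" "hcod k = X"
        and k_comm: "\<And>j. j \<in> Obj J \<Longrightarrow> Comp R_cat (\<pi> j) k = \<xi> j" by auto
      have mem: "v \<in> verts Y \<Longrightarrow> vmap k v \<in> Lv" "e \<in> edges Y \<Longrightarrow> emap k e \<in> Le"
        "i \<in> incs Y \<Longrightarrow> imap k i \<in> Li" for v e i
        using k by (auto simp: is_hyp_mor_def X_simps)
      have eqs: "v \<in> verts Y \<Longrightarrow> pv j (vmap k v) = vmap (\<xi> j) v"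
        "e \<in> edges Y \<Longrightarrow> pe j (emap k e) = emap (\<xi> j) e"
        "i \<in> incs Y \<Longrightarrow> p j (imap k i) = imap (\<xi> j) i" if "j \<in> Obj J" for j v e i
        using Comp_R_eqD[OF k_comm[OF that]] k mem by (auto simp: \<pi>_simps)
      show "k = h"
      proof (rule hyp_mor_eqI[OF k(1) h])
        show "vmap k v = vmap h v" if "v \<in> verts (hdom h)" for v
          by (rule Lv_eq) (use that mem eqs hv in \<open>simp_all add: h_simps\<close>)
        show "emap k e = emap h e" if "e \<in> edges (hdom h)" for e
          by (rule Le_eq) (use that mem eqs he in \<open>simp_all add: h_simps\<close>)
        show "imap k i = imap h i" if "i \<in> incs (hdom h)" for i
          by (rule Li_eq) (use that mem eqs hi in \<open>simp_all add: h_simps\<close>)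
      qed (simp_all add: k h_simps)
    qed
  qed
  ultimately show ?thesis unfolding limit_cone_def by blast
qed

lemma R_cat_has_colimits:
  fixes J :: "('u::universe, 'u) cat" and D :: "('u, 'u, 'u hypergraph, 'u hyp_mor) fnctr"
  assumes J: "small_category J" and D: "is_functor J R_cat D"
  shows "\<exists>X \<iota>. colimit_cocone J R_cat D X \<iota>"
proof -
  note Dobj = hyp_diagram_simps(1)[OF D] and Darr = hyp_diagram_simps(2)[OF D]
  have small: "small (verts (FObj D j))" "small (edges (FObj D j))" "small (incs (FObj D j))"
    if "j \<in> Obj J" for j
    using Dobj[OF that] by (auto simp: is_hypergraph_def)
  obtain Cv qv where small_Cv: "small Cv"
    and "set_colimit J (\<lambda>j. verts (FObj D j)) (\<lambda>u. vmap (FArr D u)) Cv qv"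
    using small_set_colimit[OF J, where V = "\<lambda>j. verts (FObj D j)" and
        a = "\<lambda>u. vmap (FArr D u)"] small by blast
  note Cv = set_colimitD(1-3)[OF this(2)] and Cv_ex = set_colimitD(4)[OF this(2)]
  obtain Ce qe where small_Ce: "small Ce"
    and "set_colimit J (\<lambda>j. edges (FObj D j)) (\<lambda>u. emap (FArr D u)) Ce qe"
    using small_set_colimit[OF J, where V = "\<lambda>j. edges (FObj D j)" and
        a = "\<lambda>u. emap (FArr D u)"] small by blast
  note Ce = set_colimitD(1-3)[OF this(2)] and Ce_ex = set_colimitD(4)[OF this(2)]
  obtain Ci q where small_Ci: "small Ci"
    and "set_colimit J (\<lambda>j. incs (FObj D j)) (\<lambda>u. imap (FArr D u)) Ci q"
    using small_set_colimit[OF J, where V = "\<lambda>j. incs (FObj D j)" and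
        a = "\<lambda>u. imap (FArr D u)"] small by blast
  note Ci = set_colimitD(1-3)[OF this(2)] and Ci_ex = set_colimitD(4)[OF this(2)]
  have inc_comm: "inc_vert (FObj D j) (imap (FArr D u) x) = vmap (FArr D u) (inc_vert (FObj D i) x)"
    "inc_edge (FObj D j) (imap (FArr D u) x) = emap (FArr D u) (inc_edge (FObj D i) x)"
    "inc_vert (FObj D i) x \<in> verts (FObj D i)" "inc_edge (FObj D i) x \<in> edges (FObj D i)"
    if "u \<in> Hom J i j" "x \<in> incs (FObj D i)" for i j u x
    using Darr[OF that(1)] that(2) Dobj[of i] hyp_mor_inc[of "FArr D u" x]
      hypergraph_inc[of "FObj D i" x] by auto
  \<comment> \<open>Taking ends commutes with the arrows of the diagram, so end followed by
    \<open>qv j\<close> is a compatible family on incidences and factors through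
    \<open>Ci\<close>.\<close>
  have "\<exists>h. \<forall>j\<in>Obj J. \<forall>x\<in>incs (FObj D j). h (q j x) = qv j (inc_vert (FObj D j) x)"
    using inc_comm Cv(3) by (intro Ci_ex) simp
  then obtain sv where sv: "\<And>j x. j \<in> Obj J \<Longrightarrow> x \<in> incs (FObj D j) \<Longrightarrow>
      sv (q j x) = qv j (inc_vert (FObj D j) x)" by blast
  have "\<exists>h. \<forall>j\<in>Obj J. \<forall>x\<in>incs (FObj D j). h (q j x) = qe j (inc_edge (FObj D j) x)"
    using inc_comm Ce(3) by (intro Ci_ex) simp
  then obtain se where se: "\<And>j x. j \<in> Obj J \<Longrightarrow> x \<in> incs (FObj D j) \<Longrightarrow>
      se (q j x) = qe j (inc_edge (FObj D j) x)" by blast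
  \<comment> \<open>Factorization does not say where \<open>sv\<close> and \<open>se\<close> take
    their values. Every \<open>c\<close> comes from an incidence at some stage \<open>j\<close>,
    whose ends lie in the hypergraph there.\<close>
  have mem: "sv c \<in> Cv" "se c \<in> Ce" if c: "c \<in> Ci" for c
  proof -
    obtain j x where jx: "j \<in> Obj J" "x \<in> incs (FObj D j)" "c = q j x" using Ci(2)[OF c] by blast
    then show "sv c \<in> Cv" "se c \<in> Ce"
      using sv se Cv(1) Ce(1) hypergraph_inc[OF Dobj] by simp_all
  qed
  define X where "X = \<lparr>verts = Cv, edges = Ce, incs = Ci, inc_vert = restrict sv Ci,
    inc_edge = restrict se Ci\<rparr>"
  define \<iota> where "\<iota> = (\<lambda>j. \<lparr>hdom = FObj D j, hcod = X, vmap = restrict (qv j) (verts (FObj D j)),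
    emap = restrict (qe j) (edges (FObj D j)), imap = restrict (q j) (incs (FObj D j))\<rparr>)"
  have X: "is_hypergraph X"
    using small_Cv small_Ce small_Ci mem by (auto simp: is_hypergraph_def X_def)
  have X_simps: "verts X = Cv" "edges X = Ce" "incs X = Ci"
    "\<And>c. c \<in> Ci \<Longrightarrow> inc_vert X c = sv c" "\<And>c. c \<in> Ci \<Longrightarrow> inc_edge X c = se c"
    by (simp_all add: X_def)
  have \<iota>_simps: "hdom (\<iota> j) = FObj D j" "hcod (\<iota> j) = X"
    "vmap (\<iota> j) = restrict (qv j) (verts (FObj D j))"
    "emap (\<iota> j) = restrict (qe j) (edges (FObj D j))"
    "imap (\<iota> j) = restrict (q j) (incs (FObj D j))" for j
    by (simp_all add: \<iota>_def)
  have \<iota>: "is_hyp_mor (\<iota> j)" if "j \<in> Obj J" for j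
    using that X Dobj[OF that] Cv(1) Ce(1) Ci(1) sv se hypergraph_inc[OF Dobj[OF that]]
    by (auto simp: is_hyp_mor_def \<iota>_simps X_simps)
  have "cocone J R_cat D X \<iota>"
    unfolding cocone_def
  proof (intro conjI ballI allI impI)
    fix i j u assume u: "u \<in> Hom J i j"
    have "v \<in> verts (FObj D i) \<Longrightarrow> vmap (FArr D u) v \<in> verts (FObj D j)"
      "e \<in> edges (FObj D i) \<Longrightarrow> emap (FArr D u) e \<in> edges (FObj D j)"
      "x \<in> incs (FObj D i) \<Longrightarrow> imap (FArr D u) x \<in> incs (FObj D j)" for v e x
      using Darr[OF u] by (auto simp: is_hyp_mor_def)
    then show "Comp R_cat (\<iota> j) (FArr D u) = \<iota> i"
      using Darr[OF u] \<iota>[of i] \<iota>[of j] Cv(3)[OF u] Ce(3)[OF u] Ci(3)[OF u]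
      by (intro hyp_mor_eqI) (auto simp: is_hyp_mor_Comp \<iota>_simps compose_def)
  qed (use D X \<iota> in \<open>auto simp: \<iota>_simps\<close>)
  moreover have "\<exists>!h. h \<in> Hom R_cat X Y \<and> (\<forall>j\<in>Obj J. Comp R_cat h (\<iota> j) = \<xi> j)"
    if "cocone J R_cat D Y \<xi>" for Y \<xi>
  proof -
    from that have Y: "is_hypergraph Y"
      and \<xi>: "\<And>j. j \<in> Obj J \<Longrightarrow> is_hyp_mor (\<xi> j) \<and> hdom (\<xi> j) = FObj D j \<and> hcod (\<xi> j) = Y"
      and \<xi>_comm: "\<And>i j u. u \<in> Hom J i j \<Longrightarrow> Comp R_cat (\<xi> j) (FArr D u) = \<xi> i"
      by (auto simp: cocone_def)
    have \<xi>_mem: "v \<in> verts (FObj D j) \<Longrightarrow> vmap (\<xi> j) v \<in> verts Y"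
      "e \<in> edges (FObj D j) \<Longrightarrow> emap (\<xi> j) e \<in> edges Y"
      "i \<in> incs (FObj D j) \<Longrightarrow> imap (\<xi> j) i \<in> incs Y" if "j \<in> Obj J" for j v e i
      using \<xi>[OF that] by (auto simp: is_hyp_mor_def)
    have \<xi>_eq: "v \<in> verts (FObj D i) \<Longrightarrow> vmap (\<xi> j) (vmap (FArr D u) v) = vmap (\<xi> i) v"
      "e \<in> edges (FObj D i) \<Longrightarrow> emap (\<xi> j) (emap (FArr D u) e) = emap (\<xi> i) e"
      "k \<in> incs (FObj D i) \<Longrightarrow> imap (\<xi> j) (imap (FArr D u) k) = imap (\<xi> i) k"
      if "u \<in> Hom J i j" for i j u v e k
      using Comp_R_eqD[OF \<xi>_comm[OF that]] Darr[OF that] by auto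
    have "\<exists>h. \<forall>j\<in>Obj J. \<forall>x\<in>verts (FObj D j). h (qv j x) = vmap (\<xi> j) x"
      by (rule Cv_ex) (rule \<xi>_eq)
    then obtain hv where hv: "\<And>j x. j \<in> Obj J \<Longrightarrow> x \<in> verts (FObj D j) \<Longrightarrow>
        hv (qv j x) = vmap (\<xi> j) x" by blast
    have "\<exists>h. \<forall>j\<in>Obj J. \<forall>x\<in>edges (FObj D j). h (qe j x) = emap (\<xi> j) x"
      by (rule Ce_ex) (rule \<xi>_eq)
    then obtain he where he: "\<And>j x. j \<in> Obj J \<Longrightarrow> x \<in> edges (FObj D j) \<Longrightarrow>
        he (qe j x) = emap (\<xi> j) x" by blast
    have "\<exists>h. \<forall>j\<in>Obj J. \<forall>x\<in>incs (FObj D j). h (q j x) = imap (\<xi> j) x"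
      by (rule Ci_ex) (rule \<xi>_eq)
    then obtain hi where hi: "\<And>j x. j \<in> Obj J \<Longrightarrow> x \<in> incs (FObj D j) \<Longrightarrow>
        hi (q j x) = imap (\<xi> j) x" by blast
    define h where "h = \<lparr>hdom = X, hcod = Y, vmap = restrict hv Cv,
      emap = restrict he Ce, imap = restrict hi Ci\<rparr>"
    have h_simps: "hdom h = X" "hcod h = Y" "vmap h = restrict hv Cv"
      "emap h = restrict he Ce" "imap h = restrict hi Ci"
      by (simp_all add: h_def)
    have hv_mem: "hv c \<in> verts Y" if "c \<in> Cv" for c
      using Cv(2)[OF that] hv \<xi>_mem by auto
    have he_mem: "he c \<in> edges Y" if "c \<in> Ce" for c
      using Ce(2)[OF that] he \<xi>_mem by auto
    have hi_mem: "hi c \<in> incs Y" if "c \<in> Ci" for c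
      using Ci(2)[OF that] hi \<xi>_mem by auto
    \<comment> \<open>Checked on \<open>c = q j x\<close>, which exhausts \<open>Ci\<close>; there
      it says that \<open>\<xi> j\<close> respects ends.\<close>
    have "inc_vert Y (hi c) = hv (sv c) \<and> inc_edge Y (hi c) = he (se c)" if c: "c \<in> Ci" for c
    proof -
      obtain j x where jx: "j \<in> Obj J" "x \<in> incs (FObj D j)" "c = q j x"
        using Ci(2)[OF c] by blast
      then show ?thesis
        using hyp_mor_inc[of "\<xi> j" x] \<xi>[OF jx(1)] hypergraph_inc[OF Dobj[OF jx(1)] jx(2)]
        by (simp add: hi sv se hv he)
    qed
    then have h: "is_hyp_mor h"
      using X Y hv_mem he_mem hi_mem mem by (auto simp: is_hyp_mor_def h_simps X_simps)
    show ?thesis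
    proof (rule ex1I[of _ h], intro conjI ballI)
      show "h \<in> Hom R_cat X Y" using h h_simps by simp
      show "Comp R_cat h (\<iota> j) = \<xi> j" if "j \<in> Obj J" for j
        using \<xi>[OF that] \<iota>[OF that] h that hv he hi Cv(1) Ce(1) Ci(1)
        by (intro hyp_mor_eqI) (auto simp: is_hyp_mor_Comp \<iota>_simps h_simps compose_def)
      fix k assume "k \<in> Hom R_cat X Y \<and> (\<forall>j\<in>Obj J. Comp R_cat k (\<iota> j) = \<xi> j)"
      then have k: "is_hyp_mor k" "hdom k = X" "hcod k = Y"
        and k_comm: "\<And>j. j \<in> Obj J \<Longrightarrow> Comp R_cat k (\<iota> j) = \<xi> j" by auto
      have eqs: "v \<in> verts (FObj D j) \<Longrightarrow> vmap k (qv j v) = vmap (\<xi> j) v"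
        "e \<in> edges (FObj D j) \<Longrightarrow> emap k (qe j e) = emap (\<xi> j) e"
        "i \<in> incs (FObj D j) \<Longrightarrow> imap k (q j i) = imap (\<xi> j) i" if "j \<in> Obj J" for j v e i
        using Comp_R_eqD[OF k_comm[OF that]] by (auto simp: \<iota>_simps)
      \<comment> \<open>Every element of the colimit comes from some stage, where
        \<open>\<xi>\<close> prescribes the value of both maps.\<close>
      show "k = h"
      proof (rule hyp_mor_eqI[OF k(1) h])
        show "vmap k c = vmap h c" if "c \<in> verts (hdom h)" for c
          using that Cv(2)[of c] eqs hv by (auto simp: h_simps X_simps)
        show "emap k c = emap h c" if "c \<in> edges (hdom h)" for c
          using that Ce(2)[of c] eqs he by (auto simp: h_simps X_simps)
        show "imap k c = imap h c" if "c \<in> incs (hdom h)" for c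
          using that Ci(2)[of c] eqs hi by (auto simp: h_simps X_simps)
      qed (simp_all add: k h_simps)
    qed
  qed
  ultimately show ?thesis unfolding colimit_cocone_def by blast
qed

text \<open>The existence clauses for \<open>N_R \<circ>\<^sub>F D\<close> keep the two transfer
  clauses from being vacuous; existence and transfer together give completeness and
  cocompleteness.\<close>

theorem mainTheorem10:
  "equivalent_categories (IStr :: ('u::universe inc_struct, 'u istr_mor) cat)
     (full_subcategory (R_cat :: ('u hypergraph, 'u hyp_mor) cat) simple_hypergraph) \<and>
   reflective (R_cat :: ('u hypergraph, 'u hyp_mor) cat) simple_hypergraph \<and>
   complete_category TYPE('u) (IStr :: ('u inc_struct, 'u istr_mor) cat) \<and>
   cocomplete_category TYPE('u) (IStr :: ('u inc_struct, 'u istr_mor) cat) \<and>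
   (\<forall>(J :: ('u, 'u) cat) (D :: ('u, 'u, 'u inc_struct, 'u istr_mor) fnctr).
      small_category J \<and> is_functor J IStr D \<longrightarrow>
        (\<exists>X \<pi>. limit_cone J R_cat (N_R \<circ>\<^sub>F D) X \<pi>) \<and>
        (\<forall>X \<pi>. limit_cone J R_cat (N_R \<circ>\<^sub>F D) X \<pi> \<longrightarrow>
           limit_cone J IStr D (FObj S_R X) (\<lambda>j. FArr S_R (\<pi> j))) \<and>
        (\<exists>X \<iota>. colimit_cocone J R_cat (N_R \<circ>\<^sub>F D) X \<iota>) \<and>
        (\<forall>X \<iota>. colimit_cocone J R_cat (N_R \<circ>\<^sub>F D) X \<iota> \<longrightarrow>
           colimit_cocone J IStr D (FObj S_R X) (\<lambda>j. FArr S_R (\<iota> j))))"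
proof -
  have lim: "\<exists>X \<pi>. limit_cone J R_cat (N_R \<circ>\<^sub>F D) X \<pi>"
    and colim: "\<exists>X \<iota>. colimit_cocone J R_cat (N_R \<circ>\<^sub>F D) X \<iota>"
    if "small_category J" "is_functor J IStr D"
    for J :: "('u, 'u) cat" and D :: "('u, 'u, 'u inc_struct, 'u istr_mor) fnctr"
    using that by (blast intro: R_cat_has_limits R_cat_has_colimits is_functor_comp is_functor_N_R)+
  have "complete_category TYPE('u) (IStr :: ('u inc_struct, 'u istr_mor) cat)"
    unfolding complete_category_def using category_IStr lim limit_cone_S_R by blast
  moreover have "cocomplete_category TYPE('u) (IStr :: ('u inc_struct, 'u istr_mor) cat)"
    unfolding cocomplete_category_def using category_IStr colim colimit_cocone_S_R by blast
  ultimately show ?thesis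
    using equivalent_IStr_simple reflective_simple lim colim limit_cone_S_R colimit_cocone_S_R
    unfolding R_arr_simps(2) by blast
qed

end
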